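(* Let $p\ge2$, let $\mu$ be a Borel probability measure on $\mathbb S^{p-1}$, let $U$ be uniformly distributed on $\mathbb S^{p-1}$, and suppose that $$I_\mu(U):=\int_{\mathbb S^{p-1}}\frac1{|a^\top U|}\,\mu(\mathrm da)<\infty\quad\text{almost surely}.$$ At every $u\in\mathbb S^{p-1}$ with $I_\mu(u)<\infty$ define the absolutely convergent Bochner integral $$g_\mu(u):=\int_{\mathbb S^{p-1}}\frac{a}{a^\top u}\,\mu(\mathrm da),\qquad N_\mu(u):=\frac{g_\mu(u)}{\|g_\mu(u)\|},\qquad H_\mu(u):=\frac1{\|g_\mu(u)\|^2}.$$ Then $u^\top g_\mu(u)=1$ wherever the field is defined, and $$H_\mu(U)=\{U^\top N_\mu(U)\}^2\sim\mathrm{Beta}\Bigl(\tfrac12,\tfrac{p-1}2\Bigr).$$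
   Context: The integrand $1/|a^\top u|$ is taken to be $+\infty$ when $a^\top u=0$, so $I_\mu(u)<\infty$ implies $\mu\{a:a^\top u=0\}=0$. *)

theory Defs
  imports "HOL-Probability.Probability"
begin

definition sphere_borel :: "'a::euclidean_space measure"
  where "sphere_borel = restrict_space borel (sphere 0 1)"

text \<open>
  Normalised surface measure, as the cone measure: the mass of \<open>A\<close> is the relative volume of
  \<open>{t *\<^sub>R x | x \<in> A, 0 < t < 1}\<close> in the unit ball. Here \<open>sgn x = x /\<^sub>R norm x\<close>.
\<close>

definition uniform_sphere :: "'a::euclidean_space measure"
  where "uniform_sphere =
    restrict_space (distr (uniform_measure lborel (ball 0 1)) borel sgn) (sphere 0 1)"

lemma sets_uniform_sphere: "sets uniform_sphere = sets sphere_borel"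
  by (simp add: uniform_sphere_def sphere_borel_def sets_restrict_space)

lemma prob_space_uniform_sphere: "prob_space (uniform_sphere :: 'a::euclidean_space measure)"
proof -
  let ?B = "uniform_measure lborel (ball (0::'a) 1)"
  have pos: "emeasure lborel (ball (0::'a) 1) \<noteq> 0"
    using content_ball_pos[of 1 "0::'a"] by (auto simp: measure_def)
  have fin: "emeasure lborel (ball (0::'a) 1) \<noteq> \<infinity>"
    using emeasure_bounded_finite[OF bounded_ball[of "0::'a" 1]] by simp
  interpret B: prob_space ?B
    by (rule prob_space_uniform_measure[OF pos fin])
  have AE0: "AE x in ?B. x \<noteq> (0::'a)"
  proof (rule AE_uniform_measureI)
    show "ball (0::'a) 1 \<in> sets lborel" by simp
    show "AE x in lborel. x \<in> ball (0::'a) 1 \<longrightarrow> x \<noteq> 0"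
      using AE_lborel_singleton[of "0::'a"] by eventually_elim simp
  qed
  interpret D: prob_space "distr ?B borel sgn"
    by (rule B.prob_space_distr) simp
  have "AE x in distr ?B borel sgn. x \<in> sphere (0::'a) 1"
    by (subst AE_distr_iff) (use AE0 in \<open>auto simp: norm_sgn\<close>)
  then have "emeasure (distr ?B borel sgn) (sphere (0::'a) 1) = 1"
    by (subst D.emeasure_eq_1_AE) auto
  then show ?thesis
    unfolding uniform_sphere_def by (intro prob_space_restrict_space) auto
qed

text \<open>In \<^typ>\<open>ennreal\<close>, \<open>1 / 0 = \<infinity>\<close>.\<close>

definition I_field :: "'a::euclidean_space measure \<Rightarrow> 'a \<Rightarrow> ennreal"
  where "I_field \<mu> u = (\<integral>\<^sup>+ a. 1 / ennreal \<bar>a \<bullet> u\<bar> \<partial>\<mu>)"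

text \<open>
  The fields below are total functions, but carry their intended meaning only where
  \<open>I_field \<mu> u < \<infinity>\<close>.
\<close>

definition g_field :: "'a::euclidean_space measure \<Rightarrow> 'a \<Rightarrow> 'a"
  where "g_field \<mu> u = (\<integral>a. a /\<^sub>R (a \<bullet> u) \<partial>\<mu>)"

definition N_field :: "'a::euclidean_space measure \<Rightarrow> 'a \<Rightarrow> 'a"
  where "N_field \<mu> u = g_field \<mu> u /\<^sub>R norm (g_field \<mu> u)"

definition H_field :: "'a::euclidean_space measure \<Rightarrow> 'a \<Rightarrow> real"
  where "H_field \<mu> u = 1 / (norm (g_field \<mu> u))\<^sup>2"

definition beta_density :: "real \<Rightarrow> real \<Rightarrow> real \<Rightarrow> real"
  where "beta_density a b x =
    (if 0 < x \<and> x < 1 then x powr (a - 1) * (1 - x) powr (b - 1) / Beta a b else 0)"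

end

theory Submission
  imports Defs "HOL-Complex_Analysis.Complex_Analysis" "HOL-Real_Asymp.Real_Asymp"
begin

text \<open>
  Write \<open>p\<close> for the dimension and \<open>g\<close> for the field of \<open>\<mu>\<close>. That \<open>u \<bullet> g u = 1\<close> is immediate from the definition of
  \<open>g\<close>, and it bounds \<open>H\<close> by 1. The distributional claim says that the law of \<open>H\<close> at a uniform point is the same for
  all admissible \<open>\<mu>\<close> (for a point mass at \<open>a\<close> it is the law of \<open>(a \<bullet> U)\<^sup>2\<close>). The reason is a property of functions with positive real
  part that goes back to Boole: if such a function on the disc has the value 1 at the centre and imaginary boundary
  values, then these values are Cauchy distributed.

  To bring this in, let \<open>X\<close> and \<open>Y\<close> be independent standard Gaussian vectors. The law of the pair is invariant under
  multiplication of \<open>X + \<i> Y\<close> by phases. Along an orbit \<open>(X\<^sub>\<theta>, Y\<^sub>\<theta>)\<close> the quotient \<open>(a \<bullet> Y\<^sub>\<theta>) / (a \<bullet> X\<^sub>\<theta>)\<close>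
  is, up to a factor \<open>\<i>\<close>, the boundary value of a Moebius map from the disc to the right half-plane with centre value 1, as a
  function of \<open>exp (2 \<i> \<theta>)\<close>. These properties survive averaging over \<open>a\<close>, so \<open>Y\<^sub>\<theta> \<bullet> g X\<^sub>\<theta>\<close> is Cauchy distributed over
  almost every orbit (\<open>mean_exp_cauchy_transform\<close>, \<open>mean_exp_rotate_pair\<close>) and therefore \<open>Y \<bullet> g X\<close> is Cauchy distributed.
  Given \<open>X\<close>, however, \<open>Y \<bullet> g X\<close> is centred Gaussian with variance \<open>(norm (g X))\<^sup>2\<close>. Comparing characteristic functions,
  the expectation of \<open>exp (- s\<^sup>2 * (norm (g X))\<^sup>2 / 2)\<close> is \<open>exp (- s)\<close> for all \<open>s \<ge> 0\<close>
  (\<open>integral_gaussian_exp_g_field\<close>).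

  It remains to pass from \<open>X\<close> to its direction. Integrating the last identity against powers of \<open>s\<close> gives the expectations
  of \<open>(1 / (norm (g X))\<^sup>2) ^ k\<close>. Since \<open>g\<close> is homogeneous of degree \<open>-1\<close>, this power is
  \<open>norm X ^ (2 * k) * H (sgn X) ^ k\<close>, and norm and direction of \<open>X\<close> are independent (\<open>nn_integral_gaussian_polar\<close>).
  Dividing out the radial moments yields the recursion \<open>(2 k + p) m\<^sub>k\<^sub>+\<^sub>1 = (2 k + 1) m\<^sub>k\<close> for the moments of \<open>H\<close>
  (\<open>H_moment_recursion\<close>), which is that of the Beta law. As \<open>H\<close> is bounded, its moments determine its law
  (\<open>real_distribution_eq_moments\<close>).
\<close>

section \<open>Boundary values of functions with positive real part\<close>

text \<open>
  The disc is parametrised by \<open>t \<in> [0, 1]\<close> under the uniform law, so that boundary averages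
  are expectations and dominated convergence applies to them.
\<close>

abbreviation unit_interval :: "real measure"
  where "unit_interval \<equiv> uniform_measure lborel {0..1}"

lemma prob_space_unit_interval: "prob_space unit_interval"
  by (intro prob_space_uniform_measure) auto

lemma integral_unit_interval:
  fixes f :: "real \<Rightarrow> 'b::{banach, second_countable_topology}"
  assumes "f \<in> borel_measurable borel"
  shows "integral\<^sup>L unit_interval f = (LINT t:{0..1}|lborel. f t)"
proof -
  have "unit_interval = density lborel (\<lambda>t. ennreal (indicator {0..1} t))"
    unfolding uniform_measure_def
    by (intro density_cong) (auto split: split_indicator simp: divide_ennreal_def)
  then show ?thesis
    using assms by (subst (1) \<open>unit_interval = _\<close>, subst integral_density) (auto simp: set_lebesgue_integral_def)
qed

lemma circle_mean_value:
  fixes f :: "complex \<Rightarrow> complex"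
  assumes f: "f holomorphic_on ball 0 1" and r: "0 < r" "r < 1"
  shows "(\<integral>t. f (of_real r * cis (2 * pi * t)) \<partial>unit_interval) = f 0"
proof -
  have hol: "f holomorphic_on cball 0 r"
    using r by (intro holomorphic_on_subset[OF f]) auto
  have path: "circlepath 0 r t = of_real r * cis (2 * pi * t)" for t
    by (simp add: circlepath cis_conv_exp mult_ac)
  have cont: "continuous_on UNIV (\<lambda>t. f (of_real r * cis (2 * pi * t)))"
    using r by (intro continuous_on_compose2[OF holomorphic_on_imp_continuous_on[OF hol]])
      (auto intro!: continuous_intros simp: norm_mult)
  have "((\<lambda>u. f u / (u - 0)) has_contour_integral (2 * of_real pi * \<i> * f 0)) (circlepath 0 r)"
    using r by (intro Cauchy_integral_circlepath_simple hol) auto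
  then have "((\<lambda>t. (f (circlepath 0 r t) / circlepath 0 r t) * vector_derivative (circlepath 0 r) (at t within {0..1}))
      has_integral (2 * of_real pi * \<i> * f 0)) {0..1}"
    by (simp add: has_contour_integral_def)
  then have "((\<lambda>t. 2 * of_real pi * \<i> * f (of_real r * cis (2 * pi * t)))
      has_integral (2 * of_real pi * \<i> * f 0)) {0..1}"
  proof (rule has_integral_eq[rotated])
    fix t :: real assume "t \<in> {0..1}"
    then have "vector_derivative (circlepath 0 r) (at t within {0..1}) = 2 * pi * \<i> * of_real r * cis (2 * pi * t)"
      by (subst vector_derivative_circlepath01) (auto simp: cis_conv_exp mult_ac)
    then show "(f (circlepath 0 r t) / circlepath 0 r t) * vector_derivative (circlepath 0 r) (at t within {0..1})
       = 2 * of_real pi * \<i> * f (of_real r * cis (2 * pi * t))"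
      using r by (simp add: path)
  qed
  from has_integral_mult_right[OF this, of "1 / (2 * of_real pi * \<i>)"]
  have *: "((\<lambda>t. f (of_real r * cis (2 * pi * t))) has_integral f 0) {0..1}"
    by simp
  have si: "set_integrable lborel {0..1} (\<lambda>t. f (of_real r * cis (2 * pi * t)))"
    unfolding set_integrable_def
    by (intro borel_integrable_compact continuous_on_subset[OF cont]) auto
  have "f \<circ> (\<lambda>t. of_real r * cis (2 * pi * t)) \<in> borel_measurable borel"
    using borel_measurable_continuous_onI[OF cont] by (simp add: o_def)
  then show ?thesis
    using * set_borel_integral_eq_integral(2)[OF si]
    by (subst integral_unit_interval) (auto simp: o_def integral_unique)
qed

text \<open>
  Expanding \<open>1 / (1 + \<omega> a * w)\<close> in a geometric series and integrating term by term gives a power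
  series in \<open>w\<close>; its coefficients are, up to sign, the moments of \<open>\<omega>\<close>.
\<close>

lemma holomorphic_on_cauchy_transform:
  fixes \<omega> :: "'b \<Rightarrow> complex"
  assumes "prob_space \<mu>" and [measurable]: "\<omega> \<in> borel_measurable \<mu>" and \<omega>: "\<And>a. norm (\<omega> a) = 1"
  shows "(\<lambda>w. \<integral>a. 1 / (1 + \<omega> a * w) \<partial>\<mu>) holomorphic_on ball 0 1"
proof (rule power_series_holomorphic)
  interpret prob_space \<mu> by fact
  fix w :: complex assume "w \<in> ball 0 1"
  then have w: "norm w < 1" by simp
  have "(\<lambda>n. \<integral>a. (- \<omega> a * w) ^ n \<partial>\<mu>) sums (\<integral>a. (\<Sum>n. (- \<omega> a * w) ^ n) \<partial>\<mu>)"
  proof (rule sums_integral)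
    show "integrable \<mu> (\<lambda>a. (- \<omega> a * w) ^ n)" for n
      using w by (intro integrable_const_bound[where B=1]) (auto simp: norm_power norm_mult \<omega> power_le_one)
    show "AE a in \<mu>. summable (\<lambda>n. norm ((- \<omega> a * w) ^ n))"
      using w by (auto simp: norm_power norm_mult \<omega> summable_geometric)
    show "summable (\<lambda>n. \<integral>a. norm ((- \<omega> a * w) ^ n) \<partial>\<mu>)"
      using w by (auto simp: norm_power norm_mult \<omega> summable_geometric prob_space)
  qed
  also have "(\<lambda>n. \<integral>a. (- \<omega> a * w) ^ n \<partial>\<mu>) = (\<lambda>n. (\<integral>a. (- \<omega> a) ^ n \<partial>\<mu>) * (w - 0) ^ n)"
    by (simp only: power_mult_distrib diff_zero integral_mult_left_zero)
  also have "(\<integral>a. (\<Sum>n. (- \<omega> a * w) ^ n) \<partial>\<mu>) = (\<integral>a. 1 / (1 + \<omega> a * w) \<partial>\<mu>)"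
    using w by (intro Bochner_Integration.integral_cong refl) (simp add: suminf_geometric norm_mult \<omega>)
  finally show "(\<lambda>n. (\<integral>a. (- \<omega> a) ^ n \<partial>\<mu>) * (w - 0) ^ n) sums (\<integral>a. 1 / (1 + \<omega> a * w) \<partial>\<mu>)" .
qed

text \<open>
  The map \<open>z \<mapsto> 1 / (1 + z)\<close> sends the unit disc to the half-plane right of \<open>1 / 2\<close>. This is the only
  place where positivity enters: it makes the exponential in \<open>mean_exp_cauchy_transform\<close> bounded.
\<close>

lemma Re_inverse_one_plus_ge:
  fixes z :: complex
  assumes "norm z < 1"
  shows "Re (1 / (1 + z)) \<ge> 1 / 2"
proof -
  have ne: "1 + z \<noteq> 0" using assms by (metis add.commute add_cancel_right_left minus_unique norm_minus_cancel norm_one less_irrefl)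
  have "(norm (1 + z))\<^sup>2 = 1 + 2 * Re z + (norm z)\<^sup>2"
    unfolding cmod_power2 by (simp add: power2_eq_square algebra_simps)
  also have "\<dots> \<le> 2 * (1 + Re z)"
    using power_le_one[of "norm z" 2] assms by simp
  finally have "(norm (1 + z))\<^sup>2 \<le> 2 * (1 + Re z)" .
  moreover have "Re (1 / (1 + z)) = (1 + Re z) / (norm (1 + z))\<^sup>2"
    by (simp add: Re_divide_numeral Re_divide cmod_power2)
  moreover have "(norm (1 + z))\<^sup>2 > 0" using ne by simp
  ultimately show ?thesis by (simp add: pos_le_divide_eq)
qed

text \<open>
  A point on the circle is at most twice as far from \<open>-1\<close> as the points on its radius are. Hence the
  boundary integrand, up to a factor 2, dominates the integrands on the radius leading to it.
\<close>

lemma one_plus_radial_ge: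
  fixes z :: complex
  assumes "norm z = 1" "0 \<le> r" "r \<le> 1"
  shows "norm (1 + z) \<le> 2 * norm (1 + of_real r * z)"
proof -
  have "norm (1 + z) = norm ((1 + of_real r * z) + of_real (1 - r) * z)"
    by (simp add: algebra_simps)
  also have "\<dots> \<le> norm (1 + of_real r * z) + norm (of_real (1 - r) * z)"
    by (rule norm_triangle_ineq)
  also have "norm (of_real (1 - r) * z) = 1 - r"
    using assms by (simp only: norm_mult norm_of_real) simp
  also have "1 - r \<le> norm (1 + of_real r * z)"
    using norm_diff_ineq[of 1 "of_real r * z"] assms by (simp add: norm_mult)
  finally show ?thesis by simp
qed

lemma cauchy_transform_radial_limit:
  fixes \<omega> :: "'b \<Rightarrow> complex" and w :: complex
  assumes "prob_space \<mu>" and [measurable]: "\<omega> \<in> borel_measurable \<mu>" and \<omega>: "\<And>a. norm (\<omega> a) = 1"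
    and w: "norm w = 1" and fin: "(\<integral>\<^sup>+a. 1 / ennreal (norm (1 + \<omega> a * w)) \<partial>\<mu>) < \<infinity>"
    and r: "\<And>n. 0 \<le> r n" "\<And>n. r n < 1" "r \<longlonglongrightarrow> 1"
  shows "(\<lambda>n. \<integral>a. 1 / (1 + \<omega> a * (of_real (r n) * w)) \<partial>\<mu>) \<longlonglongrightarrow> (\<integral>a. 1 / (1 + \<omega> a * w) \<partial>\<mu>)"
proof (rule integral_dominated_convergence[where w = "\<lambda>a. 2 / norm (1 + \<omega> a * w)"])
  have AE: "AE a in \<mu>. 1 + \<omega> a * w \<noteq> 0"
    using nn_integral_noteq_infinite[of "\<lambda>a. 1 / ennreal (norm (1 + \<omega> a * w))" \<mu>] fin
    by (auto simp: divide_ennreal_def)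
  show "integrable \<mu> (\<lambda>a. 2 / norm (1 + \<omega> a * w))"
  proof (rule integrableI_bounded)
    have "(\<integral>\<^sup>+ a. ennreal (norm (2 / norm (1 + \<omega> a * w))) \<partial>\<mu>) =
        (\<integral>\<^sup>+ a. 2 * (1 / ennreal (norm (1 + \<omega> a * w))) \<partial>\<mu>)"
    proof (rule nn_integral_cong_AE, use AE in eventually_elim)
      fix a assume "1 + \<omega> a * w \<noteq> 0"
      then show "ennreal (norm (2 / norm (1 + \<omega> a * w))) = 2 * (1 / ennreal (norm (1 + \<omega> a * w)))"
        by (simp add: divide_ennreal_def inverse_ennreal divide_real_def ennreal_mult)
    qed
    also have "\<dots> = 2 * (\<integral>\<^sup>+ a. 1 / ennreal (norm (1 + \<omega> a * w)) \<partial>\<mu>)"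
      by (rule nn_integral_cmult) measurable
    also have "\<dots> < \<infinity>" using fin by (simp add: ennreal_mult_less_top)
    finally show "(\<integral>\<^sup>+ a. ennreal (norm (2 / norm (1 + \<omega> a * w))) \<partial>\<mu>) < \<infinity>" .
  qed measurable
  show "AE a in \<mu>. (\<lambda>n. 1 / (1 + \<omega> a * (of_real (r n) * w))) \<longlonglongrightarrow> 1 / (1 + \<omega> a * w)"
    using AE
  proof eventually_elim
    fix a assume "1 + \<omega> a * w \<noteq> 0"
    then have "(\<lambda>n. 1 / (1 + \<omega> a * (of_real (r n) * w))) \<longlonglongrightarrow> 1 / (1 + \<omega> a * (of_real 1 * w))"
      using r(3) by (intro tendsto_intros) auto
    then show "(\<lambda>n. 1 / (1 + \<omega> a * (of_real (r n) * w))) \<longlonglongrightarrow> 1 / (1 + \<omega> a * w)" by simp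
  qed
  show "AE a in \<mu>. norm (1 / (1 + \<omega> a * (of_real (r n) * w))) \<le> 2 / norm (1 + \<omega> a * w)" for n
    using AE
  proof eventually_elim
    fix a assume ne: "1 + \<omega> a * w \<noteq> 0"
    have "norm (1 + \<omega> a * w) \<le> 2 * norm (1 + of_real (r n) * (\<omega> a * w))"
      using r(1)[of n] r(2)[of n] by (intro one_plus_radial_ge) (auto simp: norm_mult \<omega> w)
    then have "norm (1 + \<omega> a * w) \<le> 2 * norm (1 + \<omega> a * (of_real (r n) * w))"
      by (simp only: mult.left_commute)
    moreover from ne have "norm (1 + \<omega> a * w) > 0" by simp
    moreover from calculation have "norm (1 + \<omega> a * (of_real (r n) * w)) > 0" by linarith
    moreover have "1 / d \<le> 2 / m" if "m \<le> 2 * d" "0 < m" "0 < d" for m d :: real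
      using that by (simp add: field_simps)
    ultimately show "norm (1 / (1 + \<omega> a * (of_real (r n) * w))) \<le> 2 / norm (1 + \<omega> a * w)"
      by (simp only: norm_divide norm_one)
  qed
qed measurable

lemma integrable_cauchy_transform_interior:
  fixes \<omega> :: "'b \<Rightarrow> complex"
  assumes "prob_space \<mu>" and [measurable]: "\<omega> \<in> borel_measurable \<mu>" and \<omega>: "\<And>a. norm (\<omega> a) = 1" and w: "norm w < 1"
  shows "integrable \<mu> (\<lambda>a. 1 / (1 + \<omega> a * w))"
proof -
  interpret prob_space \<mu> by fact
  show ?thesis
  proof (rule integrable_const_bound[where B="1 / (1 - norm w)"])
    show "AE a in \<mu>. norm (1 / (1 + \<omega> a * w)) \<le> 1 / (1 - norm w)"
    proof (rule AE_I2)
      fix a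
      have "1 - norm w \<le> norm (1 + \<omega> a * w)"
        using norm_diff_ineq[of 1 "\<omega> a * w"] by (simp add: norm_mult \<omega>)
      then show "norm (1 / (1 + \<omega> a * w)) \<le> 1 / (1 - norm w)"
        using w by (simp add: norm_divide divide_simps)
    qed
  qed measurable
qed

text \<open>
  The function \<open>w \<mapsto> 2 * K w - 1\<close>, with \<open>K w = \<integral>a. 1 / (1 + \<omega> a * w) \<partial>\<mu>\<close>, has nonnegative real part
  in the disc and the value 1 at the centre, whatever \<open>\<mu>\<close> and \<open>\<omega>\<close> are. Its exponential is therefore
  a bounded holomorphic function whose mean over every circle about the centre is its value \<open>exp (- s)\<close> at the centre;
  boundedness lets the radius tend to 1. In the situation of interest the boundary values of
  \<open>2 * K w - 1\<close> are purely imaginary, and the conclusion says that they follow the Cauchy law.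
\<close>

lemma mean_exp_cauchy_transform:
  fixes \<omega> :: "'b \<Rightarrow> complex" and s :: real
  assumes "prob_space \<mu>" and [measurable]: "\<omega> \<in> borel_measurable \<mu>" and \<omega>: "\<And>a. norm (\<omega> a) = 1"
    and s: "s \<ge> 0"
    and fin: "AE t in unit_interval. (\<integral>\<^sup>+a. 1 / ennreal (norm (1 + \<omega> a * cis (2 * pi * t))) \<partial>\<mu>) < \<infinity>"
  shows "(\<integral>t. exp (- of_real s * (2 * (\<integral>a. 1 / (1 + \<omega> a * cis (2 * pi * t)) \<partial>\<mu>) - 1)) \<partial>unit_interval) = exp (- of_real s)"
proof -
  interpret prob_space \<mu> by fact
  interpret T: prob_space unit_interval by (rule prob_space_unit_interval)
  define K where "K w = (\<integral>a. 1 / (1 + \<omega> a * w) \<partial>\<mu>)" for w :: complex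
  define F where "F w = exp (- of_real s * (2 * K w - 1))" for w :: complex
  define r where "r n = 1 - 1 / (real n + 2)" for n
  have r: "0 < r n" "r n < 1" for n by (auto simp: r_def field_simps)
  have r_lim: "r \<longlonglongrightarrow> 1" unfolding r_def by real_asymp
  have [measurable]: "cis \<in> borel_measurable borel"
    by (intro borel_measurable_continuous_onI continuous_intros)
  have [measurable]: "K \<in> borel_measurable borel"
    unfolding K_def by measurable
  then have [measurable]: "F \<in> borel_measurable borel"
    unfolding F_def by measurable
  have "K holomorphic_on ball 0 1"
    unfolding K_def by (intro holomorphic_on_cauchy_transform assms)
  then have F: "F holomorphic_on ball 0 1"
    unfolding F_def by (intro holomorphic_intros)
  have F0: "F 0 = exp (- of_real s)"
    by (simp add: F_def K_def prob_space)
  have bound: "norm (F w) \<le> 1" if w: "norm w < 1" for w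
  proof -
    have int: "integrable \<mu> (\<lambda>a. 1 / (1 + \<omega> a * w))"
      using w by (intro integrable_cauchy_transform_interior assms)
    have "Re (K w) = (\<integral>a. Re (1 / (1 + \<omega> a * w)) \<partial>\<mu>)"
      unfolding K_def using int by simp
    also have "\<dots> \<ge> (\<integral>a. 1 / 2 \<partial>\<mu>)"
      using w int by (intro integral_mono Re_inverse_one_plus_ge integrable_Re) (auto simp: norm_mult \<omega>)
    finally have "Re (K w) \<ge> 1 / 2" by (simp add: prob_space)
    then show ?thesis using s by (simp add: F_def)
  qed
  have "(\<lambda>n. \<integral>t. F (of_real (r n) * cis (2 * pi * t)) \<partial>unit_interval) \<longlonglongrightarrow> (\<integral>t. F (cis (2 * pi * t)) \<partial>unit_interval)"
  proof (rule integral_dominated_convergence[where w="\<lambda>_. 1"])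
    show "AE t in unit_interval. (\<lambda>n. F (of_real (r n) * cis (2 * pi * t))) \<longlonglongrightarrow> F (cis (2 * pi * t))"
      using fin
    proof eventually_elim
      case (elim t)
      have "(\<lambda>n. K (of_real (r n) * cis (2 * pi * t))) \<longlonglongrightarrow> K (cis (2 * pi * t))"
        unfolding K_def using r less_imp_le
        by (intro cauchy_transform_radial_limit assms elim r_lim) auto
      then show ?case
        unfolding F_def by (intro tendsto_intros)
    qed
    show "AE t in unit_interval. norm (F (of_real (r n) * cis (2 * pi * t))) \<le> 1" for n
      using r[of n] by (intro AE_I2 bound) (auto simp: norm_mult)
  qed auto
  moreover have "(\<integral>t. F (of_real (r n) * cis (2 * pi * t)) \<partial>unit_interval) = exp (- of_real s)" for n
    unfolding F0[symmetric] by (intro circle_mean_value F r)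
  ultimately show ?thesis
    by (simp add: LIMSEQ_const_iff F_def K_def)
qed

section \<open>Gaussian measure and its invariance under phase rotations\<close>

definition gaussian :: "'a::euclidean_space measure"
  where "gaussian = density lborel (\<lambda>x. ennreal (\<Prod>b\<in>Basis. std_normal_density (x \<bullet> b)))"

lemma sets_gaussian [measurable_cong, simp]: "sets (gaussian :: 'a::euclidean_space measure) = sets borel"
  and space_gaussian [simp]: "space (gaussian :: 'a::euclidean_space measure) = UNIV"
  by (simp_all add: gaussian_def)

lemma prod_std_normal_density_Basis:
  fixes x :: "'a::euclidean_space"
  shows "(\<Prod>b\<in>Basis. std_normal_density (x \<bullet> b)) = (1 / sqrt (2 * pi)) ^ DIM('a) * exp (- (norm x)\<^sup>2 / 2)"
proof -
  have "(\<Prod>b\<in>Basis. std_normal_density (x \<bullet> b)) = (1 / sqrt (2 * pi)) ^ DIM('a) * exp (\<Sum>b\<in>Basis. - (x \<bullet> b)\<^sup>2 / 2)"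
    by (simp add: std_normal_density_def prod.distrib prod_dividef power_divide exp_sum)
  also have "(\<Sum>b\<in>Basis. - (x \<bullet> b)\<^sup>2 / 2) = - (\<Sum>b\<in>Basis. (x \<bullet> b)\<^sup>2) / 2"
    by (simp add: sum_negf sum_divide_distrib)
  also have "(\<Sum>b\<in>Basis. (x \<bullet> b)\<^sup>2) = (norm x)\<^sup>2"
    unfolding power2_norm_eq_inner by (subst euclidean_inner) (simp add: power2_eq_square)
  finally show ?thesis .
qed

lemma integrable_std_normal_density_iexp:
  "integrable lborel (\<lambda>x. complex_of_real (std_normal_density x) * iexp (t * x))"
  by (rule Bochner_Integration.integrable_bound[where f="\<lambda>x. std_normal_density x * x ^ 0", OF integrable_std_normal_moment])
    (auto simp: norm_mult)

lemma integral_std_normal_density_iexp: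
  "(\<integral>x. complex_of_real (std_normal_density x) * iexp (t * x) \<partial>lborel) = exp (- (t\<^sup>2) / 2)"
proof -
  have "(\<integral>x. complex_of_real (std_normal_density x) * iexp (t * x) \<partial>lborel) = char std_normal_distribution t"
    unfolding char_def
    by (subst integral_density) (auto simp: scaleR_conv_of_real)
  then show ?thesis by (simp add: char_std_normal_distribution)
qed

text \<open>
  Lebesgue measure on a Euclidean space is the image of a product of Lebesgue measures on the line,
  so Gaussian integrals split into one-dimensional factors.
\<close>

interpretation lborel_product: product_sigma_finite "\<lambda>_ :: 'i. (lborel :: real measure)"
  by standard

lemma prob_space_gaussian: "prob_space (gaussian :: 'a::euclidean_space measure)"
proof
  interpret N: prob_space std_normal_distribution
    by (rule prob_space_normal_density) simp
  have one: "(\<integral>\<^sup>+x. ennreal (std_normal_density x) \<partial>lborel) = 1"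
    using N.emeasure_space_1 by (simp add: emeasure_density)
  have "emeasure gaussian (space (gaussian :: 'a measure)) = (\<integral>\<^sup>+x. ennreal (\<Prod>b\<in>Basis. std_normal_density ((x::'a) \<bullet> b)) \<partial>lborel)"
    by (simp add: gaussian_def emeasure_density)
  also have "\<dots> = (\<integral>\<^sup>+f. ennreal (\<Prod>b\<in>Basis. std_normal_density ((\<Sum>j\<in>Basis. f j *\<^sub>R j :: 'a) \<bullet> b)) \<partial>(\<Pi>\<^sub>M b\<in>(Basis::'a set). lborel))"
    by (subst lborel_eq, subst nn_integral_distr) auto
  also have "\<dots> = (\<integral>\<^sup>+f. (\<Prod>b\<in>(Basis::'a set). ennreal (std_normal_density (f b))) \<partial>(\<Pi>\<^sub>M b\<in>(Basis::'a set). lborel))"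
    by (simp add: prod_ennreal)
  also have "\<dots> = 1"
    by (subst lborel_product.product_nn_integral_prod) (auto simp: one)
  finally show "emeasure gaussian (space (gaussian :: 'a measure)) = 1" .
qed

lemma char_gaussian:
  fixes v :: "'a::euclidean_space"
  shows "(\<integral>y. iexp (y \<bullet> v) \<partial>gaussian) = exp (- (norm v)\<^sup>2 / 2)"
proof -
  have "(\<integral>y. iexp (y \<bullet> v) \<partial>gaussian) = (\<integral>y. (\<Prod>b\<in>Basis. std_normal_density (y \<bullet> b)) *\<^sub>R iexp (y \<bullet> v) \<partial>lborel)"
    unfolding gaussian_def by (subst integral_density) (auto simp: prod_nonneg)
  also have "\<dots> = (\<integral>f. (\<Prod>b\<in>Basis. std_normal_density ((\<Sum>j\<in>Basis. f j *\<^sub>R j :: 'a) \<bullet> b)) *\<^sub>R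
      iexp ((\<Sum>j\<in>Basis. f j *\<^sub>R j) \<bullet> v) \<partial>(\<Pi>\<^sub>M b\<in>(Basis::'a set). lborel))"
    by (subst lborel_eq, subst integral_distr) auto
  also have "\<dots> = (\<integral>f. (\<Prod>b\<in>(Basis::'a set). complex_of_real (std_normal_density (f b)) * iexp ((v \<bullet> b) * f b)) \<partial>(\<Pi>\<^sub>M b\<in>(Basis::'a set). lborel))"
  proof (rule Bochner_Integration.integral_cong[OF refl])
    fix f :: "'a \<Rightarrow> real"
    have "(\<Sum>j\<in>Basis. f j *\<^sub>R j) \<bullet> v = (\<Sum>b\<in>Basis. (v \<bullet> b) * f b)"
      unfolding inner_sum_left by (intro sum.cong refl) (simp add: inner_commute[of v] mult.commute)
    then have "iexp ((\<Sum>j\<in>Basis. f j *\<^sub>R j) \<bullet> v) = exp (\<Sum>b\<in>Basis. \<i> * complex_of_real ((v \<bullet> b) * f b))"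
      by (simp add: sum_distrib_left)
    also have "\<dots> = (\<Prod>b\<in>(Basis::'a set). iexp ((v \<bullet> b) * f b))"
      by (rule exp_sum) simp
    finally show "(\<Prod>b\<in>Basis. std_normal_density ((\<Sum>j\<in>Basis. f j *\<^sub>R j :: 'a) \<bullet> b)) *\<^sub>R iexp ((\<Sum>j\<in>Basis. f j *\<^sub>R j) \<bullet> v)
        = (\<Prod>b\<in>(Basis::'a set). complex_of_real (std_normal_density (f b)) * iexp ((v \<bullet> b) * f b))"
      by (simp add: prod.distrib scaleR_conv_of_real)
  qed
  also have "\<dots> = (\<Prod>b\<in>(Basis::'a set). complex_of_real (exp (- ((v \<bullet> b)\<^sup>2) / 2)))"
    unfolding lborel_product.product_integral_prod[OF finite_Basis integrable_std_normal_density_iexp]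
    by (intro prod.cong refl integral_std_normal_density_iexp)
  also have "\<dots> = exp (- (\<Sum>b\<in>Basis. (v \<bullet> b)\<^sup>2) / 2)"
    by (simp add: exp_sum[symmetric] sum_negf sum_divide_distrib flip: of_real_prod)
  also have "(\<Sum>b\<in>Basis. (v \<bullet> b)\<^sup>2) = (norm v)\<^sup>2"
    unfolding power2_norm_eq_inner by (subst euclidean_inner) (simp add: power2_eq_square)
  finally show ?thesis by simp
qed

lemma nn_integral_lborel_translate:
  fixes f :: "'a::euclidean_space \<Rightarrow> ennreal"
  assumes [measurable]: "f \<in> borel_measurable borel"
  shows "(\<integral>\<^sup>+x. f (x + c) \<partial>lborel) = (\<integral>\<^sup>+x. f x \<partial>lborel)"
  by (subst (2) lborel_distr_plus[of c, symmetric], subst nn_integral_distr) (auto simp: add.commute)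

text \<open>
  For fixed second component a shear is a translation. A rotation of the pair is a composition of
  three shears, which gives the invariance of Lebesgue measure under it.
\<close>

lemma nn_integral_shear_fst:
  fixes f :: "'a::euclidean_space \<times> 'a \<Rightarrow> ennreal"
  assumes [measurable]: "f \<in> borel_measurable borel"
  shows "(\<integral>\<^sup>+p. f (fst p + c *\<^sub>R snd p, snd p) \<partial>lborel) = (\<integral>\<^sup>+p. f p \<partial>lborel)"
proof -
  have [measurable]: "f \<in> borel_measurable (borel \<Otimes>\<^sub>M borel)"
    unfolding borel_prod by measurable
  have "(\<integral>\<^sup>+p. f (fst p + c *\<^sub>R snd p, snd p) \<partial>(lborel \<Otimes>\<^sub>M lborel)) = (\<integral>\<^sup>+y. \<integral>\<^sup>+x. f (x + c *\<^sub>R y, y) \<partial>lborel \<partial>lborel)"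
    by (subst lborel_pair.nn_integral_snd[symmetric]) auto
  also have "\<dots> = (\<integral>\<^sup>+y. \<integral>\<^sup>+x. f (x, y) \<partial>lborel \<partial>lborel)"
    by (intro nn_integral_cong nn_integral_lborel_translate[where f="\<lambda>x. f (x, _)"]) auto
  also have "\<dots> = (\<integral>\<^sup>+p. f p \<partial>(lborel \<Otimes>\<^sub>M lborel))"
    by (subst lborel_pair.nn_integral_snd) auto
  finally show ?thesis by (simp only: lborel_prod)
qed

lemma nn_integral_shear_snd:
  fixes f :: "'a::euclidean_space \<times> 'a \<Rightarrow> ennreal"
  assumes [measurable]: "f \<in> borel_measurable borel"
  shows "(\<integral>\<^sup>+p. f (fst p, snd p + c *\<^sub>R fst p) \<partial>lborel) = (\<integral>\<^sup>+p. f p \<partial>lborel)"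
proof -
  have [measurable]: "f \<in> borel_measurable (borel \<Otimes>\<^sub>M borel)"
    unfolding borel_prod by measurable
  have "(\<integral>\<^sup>+p. f (fst p, snd p + c *\<^sub>R fst p) \<partial>(lborel \<Otimes>\<^sub>M lborel)) = (\<integral>\<^sup>+x. \<integral>\<^sup>+y. f (x, y + c *\<^sub>R x) \<partial>lborel \<partial>lborel)"
    by (subst lborel.nn_integral_fst[symmetric]) auto
  also have "\<dots> = (\<integral>\<^sup>+x. \<integral>\<^sup>+y. f (x, y) \<partial>lborel \<partial>lborel)"
    by (intro nn_integral_cong nn_integral_lborel_translate[where f="\<lambda>y. f (_, y)"]) auto
  also have "\<dots> = (\<integral>\<^sup>+p. f p \<partial>(lborel \<Otimes>\<^sub>M lborel))"
    by (subst lborel.nn_integral_fst) auto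
  finally show ?thesis by (simp only: lborel_prod)
qed

text \<open>
  Multiplication of \<open>x + \<i> y\<close> by the phase \<open>exp (- \<i> \<theta>)\<close>, written on pairs \<open>(x, y)\<close>.
\<close>

definition rotate_pair :: "real \<Rightarrow> 'a::euclidean_space \<times> 'a \<Rightarrow> 'a \<times> 'a"
  where "rotate_pair \<theta> p = (cos \<theta> *\<^sub>R fst p + sin \<theta> *\<^sub>R snd p, cos \<theta> *\<^sub>R snd p - sin \<theta> *\<^sub>R fst p)"

lemma measurable_rotate_pair [measurable (raw)]:
  fixes g :: "'b \<Rightarrow> 'a::euclidean_space \<times> 'a"
  assumes [measurable]: "f \<in> borel_measurable M" "g \<in> M \<rightarrow>\<^sub>M borel \<Otimes>\<^sub>M borel"
  shows "(\<lambda>x. rotate_pair (f x) (g x)) \<in> M \<rightarrow>\<^sub>M borel \<Otimes>\<^sub>M borel"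
  unfolding rotate_pair_def by measurable

text \<open>
  The factorisation of a plane rotation into shears breaks down only for rotation by \<open>\<pi>\<close>, where the
  half-angle tangent is infinite. A single exceptional angle does not affect an average over angles.
\<close>

lemma rotate_pair_eq_shears:
  assumes "cos (\<theta> / 2) \<noteq> 0"
  defines "t \<equiv> tan (\<theta> / 2)" and "s \<equiv> - sin \<theta>"
  defines "S \<equiv> (\<lambda>p. (fst p + t *\<^sub>R snd p, snd p))"
  shows "rotate_pair \<theta> p = S (fst (S p), snd (S p) + s *\<^sub>R fst (S p))"
proof -
  define u where "u = \<theta> / 2"
  have \<theta>: "\<theta> = 2 * u" by (simp add: u_def)
  have c: "cos u \<noteq> 0" using assms(1) by (simp add: u_def)
  have 1: "1 + t * s = cos \<theta>"
    using c by (simp add: t_def s_def \<theta> tan_def sin_double cos_double_sin power2_eq_square)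
  have "t * (2 + t * s) = t * (1 + (1 + t * s))" by simp
  also have "\<dots> = t * (1 + cos \<theta>)" by (simp only: 1)
  also have "\<dots> = sin \<theta>"
    using c by (simp add: t_def \<theta> tan_def sin_double cos_double_cos power2_eq_square)
  finally have 2: "t * (2 + t * s) = sin \<theta>" .
  have "fst p + t *\<^sub>R snd p + t *\<^sub>R (snd p + s *\<^sub>R (fst p + t *\<^sub>R snd p))
      = (1 + t * s) *\<^sub>R fst p + (t + t + t * (t * s)) *\<^sub>R snd p"
    by (simp only: scaleR_add_left scaleR_add_right scaleR_scaleR scaleR_one) (simp only: add_ac mult_ac)
  moreover have "t + t + t * (t * s) = t * (2 + t * s)"
    by (simp add: algebra_simps)
  moreover have "snd p + s *\<^sub>R (fst p + t *\<^sub>R snd p) = (1 + t * s) *\<^sub>R snd p - sin \<theta> *\<^sub>R fst p"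
    by (simp add: algebra_simps s_def)
  ultimately show ?thesis
    by (simp add: rotate_pair_def S_def 1 2)
qed

lemma nn_integral_rotate_pair:
  fixes f :: "'a::euclidean_space \<times> 'a \<Rightarrow> ennreal"
  assumes f [measurable]: "f \<in> borel_measurable borel" and \<theta>: "cos (\<theta> / 2) \<noteq> 0"
  shows "(\<integral>\<^sup>+p. f (rotate_pair \<theta> p) \<partial>lborel) = (\<integral>\<^sup>+p. f p \<partial>lborel)"
proof -
  let ?t = "tan (\<theta> / 2)" and ?s = "- sin \<theta>"
  define f1 where "f1 p = f (fst p + ?t *\<^sub>R snd p, snd p)" for p
  define f2 where "f2 p = f1 (fst p, snd p + ?s *\<^sub>R fst p)" for p
  have [measurable]: "f1 \<in> borel_measurable borel" unfolding f1_def borel_prod[symmetric]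
    using f unfolding borel_prod[symmetric] by measurable
  then have [measurable]: "f1 \<in> borel_measurable (borel \<Otimes>\<^sub>M borel)" by (simp add: borel_prod)
  have [measurable]: "f2 \<in> borel_measurable borel" unfolding f2_def borel_prod[symmetric]
    by measurable
  have "(\<integral>\<^sup>+p. f (rotate_pair \<theta> p) \<partial>lborel) = (\<integral>\<^sup>+p. f2 (fst p + ?t *\<^sub>R snd p, snd p) \<partial>lborel)"
    by (simp add: rotate_pair_eq_shears[OF \<theta>] f1_def f2_def)
  also have "\<dots> = (\<integral>\<^sup>+p. f2 p \<partial>lborel)" by (rule nn_integral_shear_fst) measurable
  also have "\<dots> = (\<integral>\<^sup>+p. f1 p \<partial>lborel)" unfolding f2_def by (rule nn_integral_shear_snd) measurable
  also have "\<dots> = (\<integral>\<^sup>+p. f p \<partial>lborel)" unfolding f1_def by (rule nn_integral_shear_fst) measurable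
  finally show ?thesis .
qed

lemma norm_rotate_pair:
  "(norm (fst (rotate_pair \<theta> p)))\<^sup>2 + (norm (snd (rotate_pair \<theta> p)))\<^sup>2 = (norm (fst p))\<^sup>2 + (norm (snd p))\<^sup>2"
proof -
  let ?x = "fst p" and ?y = "snd p"
  have "(norm (c *\<^sub>R ?x + s *\<^sub>R ?y))\<^sup>2 + (norm (c *\<^sub>R ?y - s *\<^sub>R ?x))\<^sup>2
      = (c\<^sup>2 + s\<^sup>2) * ((norm ?x)\<^sup>2 + (norm ?y)\<^sup>2)" for c s :: real
    unfolding power2_norm_eq_inner
      inner_add_left inner_add_right inner_diff_left inner_diff_right inner_scaleR_left inner_scaleR_right
    by (simp add: inner_commute[of ?y ?x] power2_eq_square algebra_simps)
  from this[of "cos \<theta>" "sin \<theta>"] show ?thesis by (simp add: rotate_pair_def)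
qed

lemma gaussian_pair_density:
  "(gaussian \<Otimes>\<^sub>M gaussian :: ('a::euclidean_space \<times> 'a) measure) = density lborel (\<lambda>p. ennreal (
      (1 / sqrt (2 * pi)) ^ (2 * DIM('a)) * exp (- ((norm (fst p))\<^sup>2 + (norm (snd p))\<^sup>2) / 2)))"
proof -
  interpret G: prob_space "gaussian :: 'a measure" by (rule prob_space_gaussian)
  have "(gaussian \<Otimes>\<^sub>M gaussian :: ('a \<times> 'a) measure) = density (lborel \<Otimes>\<^sub>M lborel) (\<lambda>(x, y).
      ennreal (\<Prod>b\<in>Basis. std_normal_density (x \<bullet> b)) * ennreal (\<Prod>b\<in>Basis. std_normal_density (y \<bullet> b)))"
    using G.sigma_finite_measure_axioms unfolding gaussian_def
    by (intro pair_measure_density) (auto simp: lborel.sigma_finite_measure_axioms)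
  also have "\<dots> = density lborel (\<lambda>p. ennreal (
      (1 / sqrt (2 * pi)) ^ (2 * DIM('a)) * exp (- ((norm (fst p))\<^sup>2 + (norm (snd p))\<^sup>2) / 2)))"
  proof -
    have "ennreal (\<Prod>b\<in>Basis. std_normal_density (x \<bullet> b)) * ennreal (\<Prod>b\<in>Basis. std_normal_density (y \<bullet> b))
        = ennreal ((1 / sqrt (2 * pi)) ^ (2 * DIM('a)) * exp (- ((norm x)\<^sup>2 + (norm y)\<^sup>2) / 2))" for x y :: 'a
    proof -
      have "exp (- (norm x)\<^sup>2 / 2) * exp (- (norm y)\<^sup>2 / 2) = exp (- ((norm x)\<^sup>2 + (norm y)\<^sup>2) / 2)"
        by (simp add: exp_add[symmetric] add_divide_distrib)
      then show ?thesis
        unfolding prod_std_normal_density_Basis mult_2 power_add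
        by (subst ennreal_mult[symmetric]) (simp_all add: mult.assoc mult.left_commute)
    qed
    then show ?thesis
      unfolding lborel_prod by (intro arg_cong2[where f=density] refl ext) (simp add: case_prod_beta)
  qed
  finally show ?thesis .
qed

text \<open>
  The joint density depends on \<open>(x, y)\<close> only through \<open>(norm x)\<^sup>2 + (norm y)\<^sup>2\<close>, which a rotation preserves.
\<close>

lemma distr_gaussian_pair_rotate:
  assumes "cos (\<theta> / 2) \<noteq> 0"
  shows "distr (gaussian \<Otimes>\<^sub>M gaussian) (borel \<Otimes>\<^sub>M borel) (rotate_pair \<theta>) = (gaussian \<Otimes>\<^sub>M gaussian :: ('a::euclidean_space \<times> 'a) measure)"
proof (rule measure_eqI)
  show "sets (distr (gaussian \<Otimes>\<^sub>M gaussian) (borel \<Otimes>\<^sub>M borel) (rotate_pair \<theta>)) = sets (gaussian \<Otimes>\<^sub>M gaussian :: ('a \<times> 'a) measure)"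
    by (simp cong: sets_pair_measure_cong)
  fix A :: "('a \<times> 'a) set"
  assume "A \<in> sets (distr (gaussian \<Otimes>\<^sub>M gaussian) (borel \<Otimes>\<^sub>M borel) (rotate_pair \<theta>))"
  then have A: "A \<in> sets (borel \<Otimes>\<^sub>M borel)" by simp
  have "(borel \<Otimes>\<^sub>M borel :: ('a \<times> 'a) measure) = borel" by (rule borel_prod)
  with A have A' [measurable]: "A \<in> sets borel" by metis
  define \<gamma> where "\<gamma> p = ennreal ((1 / sqrt (2 * pi)) ^ (2 * DIM('a)) * exp (- ((norm (fst p))\<^sup>2 + (norm (snd p))\<^sup>2) / 2))" for p :: "'a \<times> 'a"
  have GG: "(gaussian \<Otimes>\<^sub>M gaussian :: ('a \<times> 'a) measure) = density lborel \<gamma>"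
    unfolding gaussian_pair_density \<gamma>_def ..
  have \<gamma>: "\<gamma> (rotate_pair \<theta> p) = \<gamma> p" for p by (simp only: \<gamma>_def norm_rotate_pair)
  have "\<gamma> \<in> borel_measurable (borel \<Otimes>\<^sub>M borel)" unfolding \<gamma>_def by measurable
  then have [measurable]: "\<gamma> \<in> borel_measurable borel" by (simp add: borel_prod)
  have [measurable]: "rotate_pair \<theta> \<in> borel \<rightarrow>\<^sub>M (borel :: ('a \<times> 'a) measure)"
    using measurable_rotate_pair[of "\<lambda>_. \<theta>" "borel \<Otimes>\<^sub>M borel" "\<lambda>p. p :: 'a \<times> 'a"] by (simp add: borel_prod)
  have "emeasure (distr (gaussian \<Otimes>\<^sub>M gaussian) (borel \<Otimes>\<^sub>M borel) (rotate_pair \<theta>)) A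
      = emeasure (density lborel \<gamma>) (rotate_pair \<theta> -` A)"
    using A by (subst emeasure_distr) (auto simp: GG borel_prod)
  also have "\<dots> = (\<integral>\<^sup>+p. \<gamma> p * indicator A (rotate_pair \<theta> p) \<partial>lborel)"
    using measurable_sets[of "rotate_pair \<theta>" borel borel A]
    by (subst emeasure_density) (auto simp: indicator_def intro!: nn_integral_cong)
  also have "\<dots> = (\<integral>\<^sup>+p. \<gamma> (rotate_pair \<theta> p) * indicator A (rotate_pair \<theta> p) \<partial>lborel)"
    by (simp only: \<gamma>)
  also have "\<dots> = (\<integral>\<^sup>+p. \<gamma> p * indicator A p \<partial>lborel)"
    by (rule nn_integral_rotate_pair[of "\<lambda>p. \<gamma> p * indicator A p", OF _ assms]) measurable
  also have "\<dots> = emeasure (gaussian \<Otimes>\<^sub>M gaussian) A"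
    unfolding GG by (subst emeasure_density) auto
  finally show "emeasure (distr (gaussian \<Otimes>\<^sub>M gaussian) (borel \<Otimes>\<^sub>M borel) (rotate_pair \<theta>)) A = emeasure (gaussian \<Otimes>\<^sub>M gaussian) A" .
qed

section \<open>The field at a Gaussian point\<close>

text \<open>
  Measures on the sphere are treated as measures on the ambient space that give full mass to the sphere.
  Then the fields are defined and measurable on the whole space, and not only at unit vectors, and can
  be evaluated at Gaussian points.
\<close>

locale sphere_prob = prob_space \<mu> for \<mu> :: "'a::euclidean_space measure" +
  assumes sets_eq [measurable_cong, simp]: "sets \<mu> = sets borel"
    and AE_norm: "AE a in \<mu>. norm a = 1"
begin

lemma borel_measurable_I_field [measurable]: "I_field \<mu> \<in> borel_measurable borel"
  unfolding I_field_def by measurable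

lemma borel_measurable_g_field [measurable]: "g_field \<mu> \<in> borel_measurable borel"
  unfolding g_field_def by measurable

lemma AE_inner_neq_0:
  assumes "I_field \<mu> x < \<infinity>"
  shows "AE a in \<mu>. a \<bullet> x \<noteq> 0"
proof -
  have "AE a in \<mu>. 1 / ennreal \<bar>a \<bullet> x\<bar> \<noteq> \<infinity>"
    using assms unfolding I_field_def by (intro nn_integral_noteq_infinite) auto
  then show ?thesis by eventually_elim (auto simp: divide_ennreal_def)
qed

lemma integrable_inverse_inner:
  assumes "I_field \<mu> x < \<infinity>"
  shows "integrable \<mu> (\<lambda>a. 1 / (a \<bullet> x))"
proof (rule integrableI_bounded)
  have "(\<integral>\<^sup>+a. ennreal (norm (1 / (a \<bullet> x))) \<partial>\<mu>) = I_field \<mu> x"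
    unfolding I_field_def
    by (rule nn_integral_cong_AE, use AE_inner_neq_0[OF assms] in eventually_elim)
      (simp add: divide_ennreal_def inverse_ennreal divide_real_def abs_mult)
  then show "(\<integral>\<^sup>+a. ennreal (norm (1 / (a \<bullet> x))) \<partial>\<mu>) < \<infinity>" using assms by simp
qed measurable

lemma integrable_g_field:
  assumes "I_field \<mu> x < \<infinity>"
  shows "integrable \<mu> (\<lambda>a. a /\<^sub>R (a \<bullet> x))"
proof (rule Bochner_Integration.integrable_bound[OF integrable_inverse_inner[OF assms]])
  show "AE a in \<mu>. norm (a /\<^sub>R (a \<bullet> x)) \<le> norm (1 / (a \<bullet> x))"
    using AE_norm by eventually_elim (simp add: divide_real_def)
qed measurable

lemma inner_g_field:
  assumes "I_field \<mu> x < \<infinity>"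
  shows "y \<bullet> g_field \<mu> x = (\<integral>a. (a \<bullet> y) / (a \<bullet> x) \<partial>\<mu>)"
  unfolding g_field_def
  by (subst integral_inner_right[symmetric, OF integrable_g_field[OF assms]])
    (simp add: divide_real_def inner_commute mult.commute)

lemma integrable_inner_quotient:
  assumes "I_field \<mu> x < \<infinity>"
  shows "integrable \<mu> (\<lambda>a. (a \<bullet> y) / (a \<bullet> x))"
  using integrable_inner_left[OF integrable_g_field[OF assms], of y]
  by (simp add: divide_real_def mult.commute)

lemma inner_self_g_field:
  assumes "I_field \<mu> x < \<infinity>"
  shows "x \<bullet> g_field \<mu> x = 1"
proof -
  have "(\<integral>a. (a \<bullet> x) / (a \<bullet> x) \<partial>\<mu>) = (\<integral>a. 1 \<partial>\<mu>)"
    by (rule integral_cong_AE, measurable) (use AE_inner_neq_0[OF assms] in eventually_elim, simp)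
  then show ?thesis by (simp add: inner_g_field[OF assms] prob_space)
qed

text \<open>
  With \<open>\<zeta> a = a \<bullet> x + \<i> (a \<bullet> y)\<close> the rotated pair \<open>(X, Y)\<close> satisfies
  \<open>a \<bullet> X + \<i> (a \<bullet> Y) = exp (- \<i> \<theta>) * \<zeta> a\<close>. Put \<open>\<omega> a = cnj (\<zeta> a) / \<zeta> a\<close> and \<open>w = exp (2 \<i> \<theta>)\<close>; then
  \<open>2 / (1 + \<omega> a * w) - 1 = \<i> (a \<bullet> Y) / (a \<bullet> X)\<close>. So along a rotation orbit \<open>\<i> (Y \<bullet> g X)\<close> is the boundary
  function treated by \<open>mean_exp_cauchy_transform\<close>, and \<open>Y \<bullet> g X\<close> has the Cauchy law over each orbit
  on which the field is defined almost everywhere.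
\<close>

lemma mean_exp_rotate_pair:
  fixes s :: real
  assumes s: "s \<ge> 0"
    and fin: "AE t in unit_interval. I_field \<mu> (fst (rotate_pair (pi * t) p)) < \<infinity>"
  shows "(\<integral>t. iexp (- s * (snd (rotate_pair (pi * t) p) \<bullet> g_field \<mu> (fst (rotate_pair (pi * t) p)))) \<partial>unit_interval)
    = exp (- of_real s)"
proof -
  define \<zeta> where "\<zeta> a = Complex (a \<bullet> fst p) (a \<bullet> snd p)" for a
  \<comment> \<open>The value 1 keeps \<open>\<omega>\<close> unimodular; the condition \<open>\<zeta> a = 0\<close> holds only for \<open>a\<close> in a null set.\<close>
  define \<omega> where "\<omega> a = (if \<zeta> a = 0 then 1 else cnj (\<zeta> a) / \<zeta> a)" for a
  define X where "X t = fst (rotate_pair (pi * t) p)" for t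
  define Y where "Y t = snd (rotate_pair (pi * t) p)" for t
  have "\<zeta> = (\<lambda>a. of_real (a \<bullet> fst p) + \<i> * of_real (a \<bullet> snd p))"
    by (auto simp: \<zeta>_def complex_eq_iff)
  then have [measurable]: "\<zeta> \<in> borel_measurable borel" by simp
  have [measurable]: "cnj \<in> borel_measurable borel"
    by (intro borel_measurable_continuous_onI continuous_intros)
  have [measurable]: "\<omega> \<in> borel_measurable borel"
    unfolding \<omega>_def by measurable
  have \<omega>: "norm (\<omega> a) = 1" for a
    by (auto simp: \<omega>_def norm_divide)
  have rot: "cis (- (pi * t)) * \<zeta> a = Complex (a \<bullet> X t) (a \<bullet> Y t)" for t a
    by (simp add: complex_eq_iff \<zeta>_def X_def Y_def rotate_pair_def inner_add_right inner_diff_right)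
  have \<zeta>_rot: "\<zeta> a = cis (pi * t) * Complex (a \<bullet> X t) (a \<bullet> Y t)" for t a
    by (simp add: rot[symmetric] mult.assoc[symmetric] cis_mult)
  have key: "1 + \<omega> a * cis (2 * pi * t) = 2 * of_real (a \<bullet> X t) / Complex (a \<bullet> X t) (a \<bullet> Y t)"
    if "a \<bullet> X t \<noteq> 0" for t a
  proof -
    define z where "z = Complex (a \<bullet> X t) (a \<bullet> Y t)"
    have z: "z \<noteq> 0" using that by (auto simp: z_def complex_eq_iff)
    have \<zeta>z: "\<zeta> a = cis (pi * t) * z" unfolding z_def by (rule \<zeta>_rot)
    have "\<omega> a * cis (2 * pi * t) = (cis (- (pi * t)) * cis (2 * pi * t)) * cnj z / (cis (pi * t) * z)"
      using z by (simp add: \<omega>_def \<zeta>z cis_cnj)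
    also have "cis (- (pi * t)) * cis (2 * pi * t) = cis (pi * t)"
      by (simp add: cis_mult)
    finally have "1 + \<omega> a * cis (2 * pi * t) = (z + cnj z) / z" using z by (simp add: field_simps)
    also have "z + cnj z = 2 * of_real (a \<bullet> X t)" by (simp add: z_def complex_add_cnj)
    finally show ?thesis by (simp add: z_def)
  qed
  have K: "2 * (\<integral>a. 1 / (1 + \<omega> a * cis (2 * pi * t)) \<partial>\<mu>) - 1 = \<i> * of_real (Y t \<bullet> g_field \<mu> (X t))"
    if I: "I_field \<mu> (X t) < \<infinity>" for t
  proof -
    have "(\<integral>a. 1 / (1 + \<omega> a * cis (2 * pi * t)) \<partial>\<mu>) = (\<integral>a. (1 + \<i> * of_real ((a \<bullet> Y t) / (a \<bullet> X t))) / 2 \<partial>\<mu>)"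
    proof (rule integral_cong_AE)
      show "AE a in \<mu>. 1 / (1 + \<omega> a * cis (2 * pi * t)) = (1 + \<i> * of_real ((a \<bullet> Y t) / (a \<bullet> X t))) / 2"
        using AE_inner_neq_0[OF I]
      proof eventually_elim
        case (elim a)
        then show ?case by (simp add: key complex_eq_iff Re_divide Im_divide power2_eq_square)
      qed
    qed measurable
    also have "\<dots> = (1 + \<i> * of_real (\<integral>a. (a \<bullet> Y t) / (a \<bullet> X t) \<partial>\<mu>)) / 2"
      using integrable_inner_quotient[OF I, of "Y t"]
      by (simp add: prob_space del: of_real_divide)
    finally have E: "(\<integral>a. 1 / (1 + \<omega> a * cis (2 * pi * t)) \<partial>\<mu>) = (1 + \<i> * of_real (\<integral>a. (a \<bullet> Y t) / (a \<bullet> X t) \<partial>\<mu>)) / 2" .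
    show ?thesis unfolding E inner_g_field[OF I] by (simp add: add_divide_distrib)
  qed
  have fin': "AE t in unit_interval. (\<integral>\<^sup>+a. 1 / ennreal (norm (1 + \<omega> a * cis (2 * pi * t))) \<partial>\<mu>) < \<infinity>"
    using fin
  proof eventually_elim
    case (elim t)
    then have I: "I_field \<mu> (X t) < \<infinity>" by (simp add: X_def)
    \<comment> \<open>On the sphere \<open>norm (\<zeta> a)\<close> is at most \<open>c\<close>, and \<open>norm (1 + \<omega> a * w) = 2 * \<bar>a \<bullet> X t\<bar> / norm (\<zeta> a)\<close>.\<close>
    define c where "c = norm (X t) + norm (Y t)"
    have "(\<integral>\<^sup>+a. 1 / ennreal (norm (1 + \<omega> a * cis (2 * pi * t))) \<partial>\<mu>) \<le> (\<integral>\<^sup>+a. ennreal c * (1 / ennreal \<bar>a \<bullet> X t\<bar>) \<partial>\<mu>)"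
    proof (rule nn_integral_mono_AE, use AE_norm AE_inner_neq_0[OF I] in eventually_elim)
      case (elim a)
      have nz: "Complex (a \<bullet> X t) (a \<bullet> Y t) \<noteq> 0" using elim by (auto simp: complex_eq_iff)
      have "norm (Complex (a \<bullet> X t) (a \<bullet> Y t)) \<le> \<bar>a \<bullet> X t\<bar> + \<bar>a \<bullet> Y t\<bar>"
        using cmod_le[of "Complex (a \<bullet> X t) (a \<bullet> Y t)"] by simp
      also have "\<dots> \<le> c"
        using Cauchy_Schwarz_ineq2[of a "X t"] Cauchy_Schwarz_ineq2[of a "Y t"] elim by (simp add: c_def)
      finally have le: "norm (Complex (a \<bullet> X t) (a \<bullet> Y t)) \<le> c" .
      have c: "c > 0" using le nz by (meson less_le_trans zero_less_norm_iff)
      have "1 / ennreal (norm (1 + \<omega> a * cis (2 * pi * t))) = ennreal (norm (Complex (a \<bullet> X t) (a \<bullet> Y t)) / (2 * \<bar>a \<bullet> X t\<bar>))"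
        using elim nz by (simp add: key norm_divide norm_mult divide_ennreal_def inverse_ennreal)
      also have "\<dots> \<le> ennreal (c / \<bar>a \<bullet> X t\<bar>)"
        using le elim c by (intro ennreal_leI frac_le) auto
      also have "\<dots> = ennreal c * (1 / ennreal \<bar>a \<bullet> X t\<bar>)"
        using elim c by (simp add: divide_ennreal_def inverse_ennreal divide_real_def ennreal_mult)
      finally show ?case .
    qed
    also have "\<dots> = ennreal c * I_field \<mu> (X t)"
      unfolding I_field_def by (rule nn_integral_cmult) measurable
    also have "\<dots> < \<infinity>" using I by (simp add: ennreal_mult_less_top)
    finally show ?case .
  qed
  have [measurable]: "X \<in> borel_measurable borel" "Y \<in> borel_measurable borel"
    unfolding X_def Y_def rotate_pair_def by (auto intro!: borel_measurable_continuous_onI continuous_intros)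
  have [measurable]: "cis \<in> borel_measurable borel"
    by (intro borel_measurable_continuous_onI continuous_intros)
  have "(\<integral>t. iexp (- s * (Y t \<bullet> g_field \<mu> (X t))) \<partial>unit_interval)
    = (\<integral>t. exp (- of_real s * (2 * (\<integral>a. 1 / (1 + \<omega> a * cis (2 * pi * t)) \<partial>\<mu>) - 1)) \<partial>unit_interval)"
  proof (rule integral_cong_AE)
    show "AE t in unit_interval. iexp (- s * (Y t \<bullet> g_field \<mu> (X t)))
        = exp (- of_real s * (2 * (\<integral>a. 1 / (1 + \<omega> a * cis (2 * pi * t)) \<partial>\<mu>) - 1))"
      using fin
    proof eventually_elim
      case (elim t)
      then show ?case by (subst K) (simp_all add: X_def mult_ac)
    qed
  qed measurable
  also have "\<dots> = exp (- of_real s)"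
    by (rule mean_exp_cauchy_transform[OF prob_space_axioms _ \<omega> s fin']) measurable
  finally show ?thesis by (simp only: X_def Y_def)
qed

text \<open>
  For independent Gaussian vectors \<open>X\<close> and \<open>Y\<close> the characteristic function of \<open>Y \<bullet> g X\<close> is computed in two ways.
  Rotation invariance allows averaging over the orbits first, which gives \<open>exp (- s)\<close>. Integrating over
  \<open>Y\<close> first gives the Gaussian characteristic function at \<open>s * norm (g X)\<close>. The right-hand side does
  not involve \<open>\<mu>\<close>.
\<close>

lemma integral_gaussian_exp_g_field:
  fixes s :: real
  assumes s: "s \<ge> 0" and fin: "AE x in gaussian. I_field \<mu> x < \<infinity>"
  shows "(\<integral>x. exp (- s\<^sup>2 * (norm (g_field \<mu> x))\<^sup>2 / 2) \<partial>gaussian) = exp (- s)"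
proof -
  interpret G: prob_space "gaussian :: 'a measure" by (rule prob_space_gaussian)
  interpret GG: pair_prob_space "gaussian :: 'a measure" "gaussian :: 'a measure" ..
  interpret T: prob_space unit_interval by (rule prob_space_unit_interval)
  interpret TGG: pair_prob_space unit_interval "gaussian \<Otimes>\<^sub>M gaussian :: ('a \<times> 'a) measure" ..
  define f where "f p = iexp (- s * (snd p \<bullet> g_field \<mu> (fst p)))" for p :: "'a \<times> 'a"
  have [measurable]: "f \<in> borel_measurable (borel \<Otimes>\<^sub>M borel)"
    unfolding f_def by measurable
  have sets_GG [measurable_cong]: "sets (gaussian \<Otimes>\<^sub>M gaussian :: ('a \<times> 'a) measure) = sets (borel \<Otimes>\<^sub>M borel)"
    by (simp cong: sets_pair_measure_cong)
  have norm_f: "norm (f p) = 1" for p by (simp add: f_def)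
  have AE_cos: "AE t in unit_interval. cos (pi * t / 2) \<noteq> 0"
  proof (rule AE_uniform_measureI)
    show "AE t in lborel. t \<in> {0..1} \<longrightarrow> cos (pi * t / 2) \<noteq> 0"
      using AE_lborel_singleton[of "1::real"]
    proof eventually_elim
      case (elim t)
      have "cos (pi * t / 2) > 0" if "0 \<le> t" "t \<le> 1"
        using that elim by (intro cos_gt_zero_pi) (auto simp: field_simps intro: order.strict_trans2[of _ 0])
      then show ?case by force
    qed
  qed simp
  have AE_fst: "AE p in (gaussian \<Otimes>\<^sub>M gaussian :: ('a \<times> 'a) measure). I_field \<mu> (fst p) < \<infinity>"
  proof -
    have *: "distr (gaussian \<Otimes>\<^sub>M gaussian :: ('a \<times> 'a) measure) gaussian fst = gaussian"
      by (rule G.distr_pair_fst)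
    have "AE x in distr (gaussian \<Otimes>\<^sub>M gaussian) gaussian (fst :: 'a \<times> 'a \<Rightarrow> 'a). I_field \<mu> x < \<infinity>"
      unfolding * by (rule fin)
    then show ?thesis by (subst (asm) AE_distr_iff) auto
  qed
  have "AE t in unit_interval. AE p in gaussian \<Otimes>\<^sub>M gaussian. I_field \<mu> (fst (rotate_pair (pi * t) p)) < \<infinity>"
    using AE_cos
  proof eventually_elim
    case (elim t)
    have "AE p in distr (gaussian \<Otimes>\<^sub>M gaussian) (borel \<Otimes>\<^sub>M borel) (rotate_pair (pi * t)). I_field \<mu> (fst p) < \<infinity>"
      using AE_fst by (subst distr_gaussian_pair_rotate[OF elim])
    then show ?case by (subst (asm) AE_distr_iff) auto
  qed
  then have fin_rot: "AE p in gaussian \<Otimes>\<^sub>M gaussian. AE t in unit_interval. I_field \<mu> (fst (rotate_pair (pi * t) p)) < \<infinity>"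
  proof (subst (asm) TGG.AE_commute)
    show "{q \<in> space (unit_interval \<Otimes>\<^sub>M (gaussian \<Otimes>\<^sub>M gaussian)). I_field \<mu> (fst (rotate_pair (pi * fst q) (snd q))) < \<infinity>}
        \<in> sets (unit_interval \<Otimes>\<^sub>M (gaussian \<Otimes>\<^sub>M gaussian))"
      by measurable
  qed
  have "(\<integral>p. f p \<partial>(gaussian \<Otimes>\<^sub>M gaussian)) = (\<integral>t. (\<integral>p. f (rotate_pair (pi * t) p) \<partial>(gaussian \<Otimes>\<^sub>M gaussian)) \<partial>unit_interval)"
  proof -
    have "(\<integral>t. (\<integral>p. f (rotate_pair (pi * t) p) \<partial>(gaussian \<Otimes>\<^sub>M gaussian)) \<partial>unit_interval)
        = (\<integral>t. (\<integral>p. f p \<partial>(gaussian \<Otimes>\<^sub>M gaussian)) \<partial>unit_interval)"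
    proof (rule integral_cong_AE)
      show "AE t in unit_interval. (\<integral>p. f (rotate_pair (pi * t) p) \<partial>(gaussian \<Otimes>\<^sub>M gaussian)) = (\<integral>p. f p \<partial>(gaussian \<Otimes>\<^sub>M gaussian))"
        using AE_cos
      proof eventually_elim
        case (elim t)
        have "(\<integral>p. f p \<partial>(gaussian \<Otimes>\<^sub>M gaussian)) = (\<integral>p. f p \<partial>distr (gaussian \<Otimes>\<^sub>M gaussian) (borel \<Otimes>\<^sub>M borel) (rotate_pair (pi * t)))"
          by (simp only: distr_gaussian_pair_rotate[OF elim])
        also have "\<dots> = (\<integral>p. f (rotate_pair (pi * t) p) \<partial>(gaussian \<Otimes>\<^sub>M gaussian))"
          by (rule integral_distr) measurable
        finally show ?case ..
      qed
      show "(\<lambda>t. \<integral>p. f (rotate_pair (pi * t) p) \<partial>(gaussian \<Otimes>\<^sub>M gaussian)) \<in> borel_measurable unit_interval"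
        by measurable
    qed simp
    then show ?thesis by (simp add: T.prob_space)
  qed
  also have "\<dots> = (\<integral>p. (\<integral>t. f (rotate_pair (pi * t) p) \<partial>unit_interval) \<partial>(gaussian \<Otimes>\<^sub>M gaussian))"
    by (rule TGG.Fubini_integral[symmetric], rule TGG.integrable_const_bound[where B=1])
      (auto simp: norm_f split: prod.splits)
  also have "\<dots> = (\<integral>p. exp (- of_real s) \<partial>(gaussian \<Otimes>\<^sub>M gaussian :: ('a \<times> 'a) measure))"
    by (rule integral_cong_AE, measurable)
      (use fin_rot in eventually_elim, unfold f_def, rule mean_exp_rotate_pair[OF s])
  also have "\<dots> = exp (- of_real s)"
    by (simp add: GG.prob_space)
  finally have "(\<integral>p. f p \<partial>(gaussian \<Otimes>\<^sub>M gaussian)) = exp (- of_real s)" .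
  moreover have "(\<integral>p. f p \<partial>(gaussian \<Otimes>\<^sub>M gaussian)) = (\<integral>x. (\<integral>y. f (x, y) \<partial>gaussian) \<partial>gaussian)"
    by (rule GG.integral_fst'[symmetric], rule GG.integrable_const_bound[where B=1]) (auto simp: norm_f)
  moreover have "(\<integral>y. f (x, y) \<partial>gaussian) = of_real (exp (- s\<^sup>2 * (norm (g_field \<mu> x))\<^sup>2 / 2))" for x
    using char_gaussian[of "- s *\<^sub>R g_field \<mu> x"] by (simp add: f_def power_mult_distrib)
  moreover have "exp (- of_real s) = complex_of_real (exp (- s))"
    by (simp add: exp_of_real[symmetric])
  ultimately have "(\<integral>x. complex_of_real (exp (- s\<^sup>2 * (norm (g_field \<mu> x))\<^sup>2 / 2)) \<partial>gaussian) = of_real (exp (- s))"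
    by simp
  then show ?thesis by (simp only: integral_complex_of_real of_real_eq_iff)
qed

end

section \<open>Radial integration, Gaussian moments and the moment problem\<close>

lemma nn_integral_lborel_scale:
  fixes f :: "'a::euclidean_space \<Rightarrow> ennreal"
  assumes [measurable]: "f \<in> borel_measurable borel" and "c > 0"
  shows "(\<integral>\<^sup>+x. f x \<partial>lborel) = ennreal (c ^ DIM('a)) * (\<integral>\<^sup>+x. f (c *\<^sub>R x) \<partial>lborel)"
  using \<open>c > 0\<close>
  by (subst lborel_affine[of c 0]) (simp_all add: nn_integral_density nn_integral_distr nn_integral_cmult)

lemma sgn_scaleR_pos: "c > 0 \<Longrightarrow> sgn (c *\<^sub>R x) = sgn (x :: 'a::real_normed_vector)"
  by (simp add: sgn_div_norm)

text \<open>
  Weighting Lebesgue measure by a function of the direction and pushing it forward along the norm gives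
  a measure on the line. For \<open>r > 0\<close> it gives \<open>{..<r}\<close>, by scaling, \<open>r ^ DIM('a)\<close> times the mass of the unit ball.
  Because that mass is finite, the values on these rays determine the measure.
\<close>

lemma nn_integral_polar:
  fixes h :: "'a::euclidean_space \<Rightarrow> ennreal" and w :: "real \<Rightarrow> ennreal"
  assumes [measurable]: "h \<in> borel_measurable borel" "w \<in> borel_measurable borel"
    and fin: "(\<integral>\<^sup>+x. h (sgn x) * indicator (ball 0 1) x \<partial>lborel) < \<infinity>"
  shows "(\<integral>\<^sup>+x. w (norm x) * h (sgn x) \<partial>lborel) =
    (\<integral>\<^sup>+r. w r * (ennreal (DIM('a) * r ^ (DIM('a) - 1)) * indicator {0..} r) \<partial>lborel) * (\<integral>\<^sup>+x. h (sgn x) * indicator (ball 0 1) x \<partial>lborel)"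
proof -
  define C where "C = (\<integral>\<^sup>+x. h (sgn x) * indicator (ball 0 1) x \<partial>lborel)"
  define M1 where "M1 = distr (density lborel (\<lambda>x. h (sgn x))) borel (norm :: 'a \<Rightarrow> real)"
  define M2 where "M2 = density lborel (\<lambda>r. C * (ennreal (DIM('a) * r ^ (DIM('a) - 1)) * indicator {0..} r))"
  have DIM: "DIM('a) = Suc (DIM('a) - 1)" by simp
  have M1: "emeasure M1 {..<r} = ennreal ((max r 0) ^ DIM('a)) * C" for r
  proof -
    have "emeasure M1 {..<r} = emeasure (density lborel (\<lambda>x. h (sgn x))) (ball 0 r)"
      unfolding M1_def by (subst emeasure_distr) (auto intro!: arg_cong2[where f=emeasure])
    also have "\<dots> = (\<integral>\<^sup>+x. h (sgn x) * indicator (ball 0 r) x \<partial>lborel)"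
      by (subst emeasure_density) auto
    also have "\<dots> = ennreal ((max r 0) ^ DIM('a)) * C"
    proof (cases "r > 0")
      case True
      have [measurable]: "(\<lambda>x. indicator (ball (0::'a) r) x :: ennreal) \<in> borel_measurable borel"
        by (rule borel_measurable_indicator) simp
      have "(\<integral>\<^sup>+x. h (sgn x) * indicator (ball 0 r) x \<partial>lborel)
          = ennreal (r ^ DIM('a)) * (\<integral>\<^sup>+x. h (sgn (r *\<^sub>R x)) * indicator (ball 0 r) (r *\<^sub>R x) \<partial>lborel)"
        by (intro nn_integral_lborel_scale True) measurable
      also have "(\<integral>\<^sup>+x. h (sgn (r *\<^sub>R x)) * indicator (ball 0 r) (r *\<^sub>R x) \<partial>lborel) = C"
        unfolding C_def using True by (intro nn_integral_cong) (simp add: sgn_scaleR_pos indicator_def)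
      finally show ?thesis using True by simp
    next
      case False
      then have e: "ball (0::'a) r = {}" by simp
      show ?thesis unfolding e using False by (simp add: max_def zero_power)
    qed
    finally show ?thesis .
  qed
  have M2: "emeasure M2 {..<r} = ennreal ((max r 0) ^ DIM('a)) * C" for r
  proof -
    have "emeasure M2 {..<r} = (\<integral>\<^sup>+t. C * (ennreal (DIM('a) * t ^ (DIM('a) - 1)) * indicator {0..} t * indicator {..<r} t) \<partial>lborel)"
      unfolding M2_def by (subst emeasure_density) (auto simp: mult_ac)
    also have "\<dots> = C * (\<integral>\<^sup>+t. ennreal (DIM('a) * t ^ (DIM('a) - 1)) * indicator {0..} t * indicator {..<r} t \<partial>lborel)"
      by (rule nn_integral_cmult) measurable
    also have "(\<integral>\<^sup>+t. ennreal (DIM('a) * t ^ (DIM('a) - 1)) * indicator {0..} t * indicator {..<r} t \<partial>lborel)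
        = (\<integral>\<^sup>+t. ennreal (DIM('a) * t ^ (DIM('a) - 1)) * indicator {0..max r 0} t \<partial>lborel)"
      by (rule nn_integral_cong_AE, use AE_lborel_singleton[of r] AE_lborel_singleton[of "0::real"] in eventually_elim)
        (auto simp: indicator_def)
    also have "\<dots> = ennreal ((max r 0) ^ DIM('a) - 0 ^ DIM('a))"
    proof (rule nn_integral_FTC_Icc)
      show "DERIV (\<lambda>t. t ^ DIM('a)) t :> DIM('a) * t ^ (DIM('a) - 1)" for t :: real
        by (rule DERIV_pow[THEN DERIV_cong]) simp
      show "(\<lambda>t. real DIM('a) * t ^ (DIM('a) - 1)) \<in> borel_measurable borel" by measurable
    qed auto
    finally show ?thesis by (simp add: zero_power mult.commute)
  qed
  have "M1 = M2"
  proof (rule measure_eqI_generator_eq[where E="range lessThan" and \<Omega>=UNIV and A="\<lambda>i. {..<real i}"])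
    show "Int_stable (range lessThan :: real set set)"
    proof -
      have "{..<a} \<inter> {..<b} = {..<min a b}" for a b :: real by auto
      then show ?thesis by (auto simp: Int_stable_def)
    qed
    have "sets (borel :: real measure) = sigma_sets UNIV (range lessThan)"
      by (subst borel_Iio) simp
    then show "sets M1 = sigma_sets UNIV (range lessThan)" "sets M2 = sigma_sets UNIV (range lessThan)"
      by (simp_all add: M1_def M2_def)
    show "emeasure M1 X = emeasure M2 X" if "X \<in> range lessThan" for X
      using that M1 M2 by auto
    show "(\<Union>i. {..<real i}) = UNIV"
      using reals_Archimedean2 by auto
    show "emeasure M1 {..<real i} \<noteq> \<infinity>" for i
      using fin by (simp add: M1 ennreal_mult_eq_top_iff C_def)
  qed auto
  have "(\<integral>\<^sup>+x. w (norm x) * h (sgn x) \<partial>lborel) = (\<integral>\<^sup>+r. w r \<partial>M1)"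
    unfolding M1_def by (subst nn_integral_distr, simp, simp, subst nn_integral_density) (auto simp: mult.commute)
  also have "\<dots> = (\<integral>\<^sup>+r. w r * (ennreal (DIM('a) * r ^ (DIM('a) - 1)) * indicator {0..} r) * C \<partial>lborel)"
    unfolding \<open>M1 = M2\<close> M2_def by (subst nn_integral_density) (auto simp: mult_ac)
  also have "\<dots> = (\<integral>\<^sup>+r. w r * (ennreal (DIM('a) * r ^ (DIM('a) - 1)) * indicator {0..} r) \<partial>lborel) * C"
    by (rule nn_integral_multc) measurable
  finally show ?thesis by (simp add: C_def)
qed

text \<open>
  These are the integrals of \<open>r ^ m * exp (- r\<^sup>2 / 2)\<close> over the positive half-line. They arise twice: as radial
  parts of Gaussian integrals and from integrating the Gaussian transform in its parameter \<open>s\<close>. Only the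
  recursion, the positivity and the value 1 at \<open>m = 1\<close> matter.
\<close>

definition half_gaussian_moment :: "nat \<Rightarrow> real"
  where "half_gaussian_moment m = sqrt (2 * pi) / 2 * (\<integral>x. std_normal_density x * \<bar>x\<bar> ^ m \<partial>lborel)"

lemma nn_integral_half_gaussian_moment:
  "(\<integral>\<^sup>+r. ennreal (r ^ m * exp (- r\<^sup>2 / 2)) * indicator {0..} r \<partial>lborel) = ennreal (half_gaussian_moment m)"
proof -
  let ?f = "\<lambda>r::real. ennreal (\<bar>r\<bar> ^ m * exp (- r\<^sup>2 / 2))"
  let ?I = "\<integral>\<^sup>+r. ?f r * indicator {0..} r \<partial>lborel"
  have neg: "(\<integral>\<^sup>+r. ?f r * indicator {..0} r \<partial>lborel) = ?I"
    by (subst nn_integral_real_affine[where c="-1" and t=0]) (auto simp: indicator_def intro!: nn_integral_cong)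
  have "(\<integral>\<^sup>+r. ?f r \<partial>lborel) = (\<integral>\<^sup>+r. ?f r * indicator {..0} r + ?f r * indicator {0..} r \<partial>lborel)"
    by (rule nn_integral_cong_AE, use AE_lborel_singleton[of "0::real"] in eventually_elim) (auto simp: indicator_def)
  also have "\<dots> = (\<integral>\<^sup>+r. ?f r * indicator {..0} r \<partial>lborel) + ?I"
    by (rule nn_integral_add) measurable
  also have "\<dots> = 2 * ?I" unfolding neg mult_2 ..
  finally have two: "(\<integral>\<^sup>+r. ?f r \<partial>lborel) = 2 * ?I" .
  have "(\<integral>\<^sup>+r. ?f r \<partial>lborel) = (\<integral>\<^sup>+r. ennreal (sqrt (2 * pi)) * ennreal (std_normal_density r * \<bar>r\<bar> ^ m) \<partial>lborel)"
    by (intro nn_integral_cong) (simp add: std_normal_density_def ennreal_mult[symmetric] mult_ac)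
  also have "\<dots> = ennreal (sqrt (2 * pi)) * (\<integral>\<^sup>+r. ennreal (std_normal_density r * \<bar>r\<bar> ^ m) \<partial>lborel)"
    by (rule nn_integral_cmult) measurable
  also have "(\<integral>\<^sup>+r. ennreal (std_normal_density r * \<bar>r\<bar> ^ m) \<partial>lborel) = ennreal (\<integral>r. std_normal_density r * \<bar>r\<bar> ^ m \<partial>lborel)"
    by (rule nn_integral_eq_integral[OF integrable_std_normal_moment_abs]) auto
  also have "ennreal (sqrt (2 * pi)) * \<dots> = ennreal (2 * half_gaussian_moment m)"
    unfolding half_gaussian_moment_def by (subst ennreal_mult[symmetric]) auto
  also have "\<dots> = 2 * ennreal (half_gaussian_moment m)"
    unfolding half_gaussian_moment_def by (subst ennreal_mult) auto
  finally have "2 * ?I = 2 * ennreal (half_gaussian_moment m)" using two by simp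
  then have "?I = ennreal (half_gaussian_moment m)"
    by (subst (asm) ennreal_mult_cancel_left) auto
  moreover have "(\<integral>\<^sup>+r. ennreal (r ^ m * exp (- r\<^sup>2 / 2)) * indicator {0..} r \<partial>lborel) = ?I"
    by (intro nn_integral_cong) (auto simp: indicator_def)
  ultimately show ?thesis by simp
qed

lemma half_gaussian_moment_even:
  "half_gaussian_moment (2 * k) = sqrt (2 * pi) / 2 * (fact (2 * k) / (2 ^ k * fact k))"
  using integral_std_normal_moment_even[of k] by (simp add: half_gaussian_moment_def power_even_abs)

lemma half_gaussian_moment_odd: "half_gaussian_moment (2 * k + 1) = 2 ^ k * fact k"
proof -
  have "half_gaussian_moment (2 * k + 1) = sqrt (2 * pi) / 2 * (sqrt (2 / pi) * 2 ^ k * fact k)"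
    unfolding half_gaussian_moment_def integral_std_normal_moment_abs_odd ..
  also have "\<dots> = (sqrt (2 * pi) * sqrt (2 / pi)) / 2 * (2 ^ k * fact k)" by simp
  also have "sqrt (2 * pi) * sqrt (2 / pi) = 2"
    by (subst real_sqrt_mult[symmetric]) simp
  finally show ?thesis by simp
qed

lemma half_gaussian_moment_pos: "half_gaussian_moment m > 0"
  by (cases "even m") (auto elim!: evenE oddE simp: half_gaussian_moment_even half_gaussian_moment_odd[simplified])

lemma half_gaussian_moment_add_2: "half_gaussian_moment (m + 2) = (m + 1) * half_gaussian_moment m"
proof (cases "even m")
  case True
  then obtain k where m: "m = 2 * k" by (elim evenE)
  have "half_gaussian_moment (m + 2) = half_gaussian_moment (2 * Suc k)" by (simp add: m)
  also have "\<dots> = (m + 1) * half_gaussian_moment m"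
  proof -
    define F where "F = (fact (2 * k) :: real)"
    define D where "D = (2 ^ k * fact k :: real)"
    have "fact (2 * Suc k) / (2 ^ Suc k * fact (Suc k)) = ((2 * (real k + 1)) * ((2 * real k + 1) * F)) / ((2 * (real k + 1)) * D)"
      by (intro arg_cong2[where f="(/)"]) (simp_all add: F_def D_def algebra_simps)
    also have "\<dots> = ((2 * real k + 1) * F) / D"
      by (rule nonzero_mult_divide_mult_cancel_left) simp
    finally show ?thesis
      unfolding half_gaussian_moment_even m by (simp add: F_def D_def)
  qed
  finally show ?thesis by simp
next
  case False
  then obtain k where m: "m = 2 * k + 1" by (elim oddE)
  have "half_gaussian_moment (m + 2) = half_gaussian_moment (2 * Suc k + 1)" by (simp add: m)
  also have "\<dots> = (m + 1) * half_gaussian_moment m"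
    unfolding half_gaussian_moment_odd m by (simp add: field_simps)
  finally show ?thesis by simp
qed

abbreviation uniform_ball :: "'a::euclidean_space measure"
  where "uniform_ball \<equiv> uniform_measure lborel (ball 0 1)"

lemma emeasure_unit_ball:
  "emeasure lborel (ball (0::'a::euclidean_space) 1) \<noteq> 0"
  "emeasure lborel (ball (0::'a::euclidean_space) 1) \<noteq> \<infinity>"
  using content_ball_pos[of 1 "0::'a"] emeasure_bounded_finite[OF bounded_ball[of "0::'a" 1]]
  by (auto simp: measure_def)

text \<open>
  The Gaussian direction is distributed like the direction of a uniform point of the ball, independently
  of the norm. The normalising constant comes from the case of the constant function 1.
\<close>

lemma nn_integral_gaussian_polar:
  fixes h :: "'a::euclidean_space \<Rightarrow> ennreal"
  assumes [measurable]: "h \<in> borel_measurable borel"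
    and fin: "(\<integral>\<^sup>+x. h (sgn x) \<partial>uniform_ball) < \<infinity>"
  shows "(\<integral>\<^sup>+x. ennreal (norm x ^ m) * h (sgn x) \<partial>gaussian) =
    ennreal (half_gaussian_moment (m + DIM('a) - 1) / half_gaussian_moment (DIM('a) - 1)) * (\<integral>\<^sup>+x. h (sgn x) \<partial>uniform_ball)"
proof -
  let ?p = "DIM('a)"
  define c where "c = (1 / sqrt (2 * pi)) ^ ?p"
  define V where "V = measure lborel (ball (0::'a) 1)"
  have c: "c > 0" by (simp add: c_def)
  have V: "V > 0" by (simp add: V_def content_ball_pos)
  have Ve: "emeasure lborel (ball (0::'a) 1) = ennreal V"
    unfolding V_def using emeasure_unit_ball(2)[where 'a='a] by (simp add: emeasure_eq_ennreal_measure)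
  have main: "(\<integral>\<^sup>+x. ennreal (norm x ^ m) * f (sgn x) \<partial>gaussian) =
      ennreal (c * ?p * V * half_gaussian_moment (m + ?p - 1)) * (\<integral>\<^sup>+x. f (sgn x) \<partial>uniform_ball)"
    if [measurable]: "f \<in> borel_measurable borel" and fin_f: "(\<integral>\<^sup>+x. f (sgn x) \<partial>uniform_ball) < \<infinity>" for f :: "'a \<Rightarrow> ennreal" and m
  proof -
    let ?J = "\<integral>\<^sup>+x. f (sgn x) * indicator (ball 0 1) x \<partial>lborel"
    have "(\<integral>\<^sup>+x. f (sgn x) \<partial>uniform_ball) = ?J / ennreal V"
      by (subst nn_integral_uniform_measure) (auto simp: Ve)
    then have J: "?J = ennreal V * (\<integral>\<^sup>+x. f (sgn x) \<partial>uniform_ball)"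
      using V by (simp add: ennreal_times_divide mult_divide_eq_ennreal mult.commute[of "ennreal V"])
    have J_fin: "?J < \<infinity>" unfolding J using fin_f by (simp add: ennreal_mult_less_top)
    define w where "w r = ennreal (c * exp (- r\<^sup>2 / 2) * r ^ m)" for r
    have [measurable]: "w \<in> borel_measurable borel" unfolding w_def by measurable
    have "(\<integral>\<^sup>+x. ennreal (norm x ^ m) * f (sgn x) \<partial>gaussian) = (\<integral>\<^sup>+x. w (norm x) * f (sgn x) \<partial>lborel)"
      unfolding gaussian_def prod_std_normal_density_Basis
      by (subst nn_integral_density) (auto simp: w_def c_def ennreal_mult mult_ac intro!: nn_integral_cong)
    also have "\<dots> = (\<integral>\<^sup>+r. w r * (ennreal (?p * r ^ (?p - 1)) * indicator {0..} r) \<partial>lborel) * ?J"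
      by (rule nn_integral_polar[OF _ _ J_fin]) measurable
    also have "(\<integral>\<^sup>+r. w r * (ennreal (?p * r ^ (?p - 1)) * indicator {0..} r) \<partial>lborel)
        = (\<integral>\<^sup>+r. ennreal (c * ?p) * (ennreal (r ^ (m + ?p - 1) * exp (- r\<^sup>2 / 2)) * indicator {0..} r) \<partial>lborel)"
    proof (intro nn_integral_cong)
      fix r :: real
      have "m + ?p - 1 = m + (?p - 1)" using DIM_positive[where 'a='a] by linarith
      then have "r ^ (m + ?p - 1) = r ^ m * r ^ (?p - 1)" by (simp only: power_add)
      then show "w r * (ennreal (?p * r ^ (?p - 1)) * indicator {0..} r)
          = ennreal (c * ?p) * (ennreal (r ^ (m + ?p - 1) * exp (- r\<^sup>2 / 2)) * indicator {0..} r)"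
        using c by (auto simp: w_def indicator_def ennreal_mult[symmetric] mult_ac simp del: One_nat_def)
    qed
    also have "\<dots> = ennreal (c * ?p) * (\<integral>\<^sup>+r. ennreal (r ^ (m + ?p - 1) * exp (- r\<^sup>2 / 2)) * indicator {0..} r \<partial>lborel)"
      by (rule nn_integral_cmult) auto
    also have "\<dots> = ennreal (c * ?p) * ennreal (half_gaussian_moment (m + ?p - 1))"
      by (simp only: nn_integral_half_gaussian_moment)
    finally show ?thesis
      unfolding J using c V half_gaussian_moment_pos[of "m + ?p - 1"]
      by (simp add: ennreal_mult mult_ac)
  qed
  interpret G: prob_space "gaussian :: 'a measure" by (rule prob_space_gaussian)
  interpret B: prob_space "uniform_ball :: 'a measure" by (rule prob_space_uniform_measure[OF emeasure_unit_ball])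
  have "1 = ennreal (c * ?p * V * half_gaussian_moment (?p - 1))"
    using main[of "\<lambda>_. 1" 0] G.emeasure_space_1 B.emeasure_space_1 by simp
  then have "c * ?p * V * half_gaussian_moment (?p - 1) = 1"
    by (metis ennreal_eq_1)
  then have "c * ?p * V = 1 / half_gaussian_moment (?p - 1)"
    using half_gaussian_moment_pos[of "?p - 1"] by (simp add: field_simps)
  then show ?thesis using main[OF assms, of m] by simp
qed

text \<open>
  For distributions on a bounded interval the Taylor expansion of the characteristic function converges,
  so the moments determine the characteristic function and hence the distribution.
\<close>

lemma real_distribution_eq_moments:
  assumes M: "real_distribution M" and N: "real_distribution N"
    and bound: "AE x in M. \<bar>x\<bar> \<le> 1" "AE x in N. \<bar>x\<bar> \<le> 1"
    and eq: "\<And>k. (\<integral>x. x ^ k \<partial>M) = (\<integral>x. x ^ k \<partial>N)"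
  shows "M = N"
proof (rule Levy_uniqueness[OF M N], rule ext)
  fix t :: real
  define S where "S n = (\<Sum>k\<le>n. ((\<i> * t) ^ k / fact k) * (\<integral>x. x ^ k \<partial>M))" for n
  have lim: "S \<longlonglongrightarrow> char L t"
    if L: "real_distribution L" "AE x in L. \<bar>x\<bar> \<le> 1" "\<And>k. (\<integral>x. x ^ k \<partial>L) = (\<integral>x. x ^ k \<partial>M)" for L
  proof -
    interpret real_distribution L by fact
    have int: "integrable L (\<lambda>x. x ^ k)" and int_abs: "integrable L (\<lambda>x. \<bar>x\<bar> ^ k)" for k
      using L(2) by (auto intro!: integrable_const_bound[where B=1] simp: power_abs power_le_one_iff elim!: eventually_mono)
    have "norm (char L t - S n) \<le> 2 * (\<bar>t\<bar> ^ n / fact n)" for n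
    proof -
      have "norm (char L t - S n) \<le> (2 * \<bar>t\<bar> ^ n / fact n) * expectation (\<lambda>x. \<bar>x\<bar> ^ n)"
        using char_approx1[of n t] int by (simp add: S_def L(3))
      also have "\<dots> \<le> (2 * \<bar>t\<bar> ^ n / fact n) * 1"
      proof (rule mult_left_mono)
        have "expectation (\<lambda>x. \<bar>x\<bar> ^ n) \<le> expectation (\<lambda>x. 1)"
          using L(2) by (intro integral_mono_AE int_abs) (auto elim!: eventually_mono intro: power_le_one)
        then show "expectation (\<lambda>x. \<bar>x\<bar> ^ n) \<le> 1" using prob_space by simp
      qed simp
      finally show ?thesis by simp
    qed
    moreover have "(\<lambda>n. 2 * (\<bar>t\<bar> ^ n / fact n)) \<longlonglongrightarrow> 0"
      using tendsto_mult_left[OF summable_LIMSEQ_zero[OF summable_exp[of "\<bar>t\<bar>"]], of 2]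
      by (simp add: field_simps)
    ultimately have "(\<lambda>n. char L t - S n) \<longlonglongrightarrow> 0"
      by (rule Lim_null_comparison[OF always_eventually[OF allI]])
    from tendsto_diff[OF tendsto_const[of "char L t"] this]
    show ?thesis by simp
  qed
  show "char M t = char N t"
    by (rule LIMSEQ_unique[OF lim[OF M bound(1) refl] lim[OF N bound(2) eq[symmetric]]])
qed

section \<open>Moments of the squared cosine\<close>

lemma (in sphere_prob) g_field_scaleR: "g_field \<mu> (c *\<^sub>R x) = g_field \<mu> x /\<^sub>R c"
  unfolding g_field_def
  by (subst integral_scaleR_right[symmetric]) (simp add: mult.commute)

lemma (in sphere_prob) I_field_sgn:
  assumes "x \<noteq> 0"
  shows "I_field \<mu> (sgn x) = ennreal (norm x) * I_field \<mu> x"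
proof -
  have "1 / ennreal \<bar>a \<bullet> sgn x\<bar> = ennreal (norm x) * (1 / ennreal \<bar>a \<bullet> x\<bar>)" for a
  proof (cases "a \<bullet> x = 0")
    case True
    then show ?thesis using assms
      by (simp add: sgn_div_norm divide_ennreal_def ennreal_mult_top)
  next
    case False
    then show ?thesis using assms
      by (simp add: sgn_div_norm divide_ennreal_def inverse_ennreal abs_mult ennreal_mult[symmetric] divide_simps)
  qed
  then show ?thesis
    unfolding I_field_def by (simp add: nn_integral_cmult)
qed

text \<open>
  As \<open>g\<close> is homogeneous of degree \<open>-1\<close>, the quantity \<open>1 / (norm (g x))\<^sup>2\<close> factors into a radial and an
  angular part.
\<close>

lemma (in sphere_prob) inverse_norm_g_field_square:
  assumes "x \<noteq> 0"
  shows "1 / (norm (g_field \<mu> x))\<^sup>2 = (norm x)\<^sup>2 * H_field \<mu> (sgn x)"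
  using assms by (simp add: H_field_def sgn_div_norm g_field_scaleR power_mult_distrib field_simps)

lemma (in sphere_prob) borel_measurable_H_field [measurable]: "H_field \<mu> \<in> borel_measurable borel"
  unfolding H_field_def by measurable

lemma (in sphere_prob) H_field_le_1:
  assumes "norm u = 1" "I_field \<mu> u < \<infinity>"
  shows "0 \<le> H_field \<mu> u" "H_field \<mu> u \<le> 1"
proof -
  have "1 \<le> norm (g_field \<mu> u)"
    using inner_self_g_field[OF assms(2)] norm_cauchy_schwarz[of u "g_field \<mu> u"] assms(1) by simp
  then show "0 \<le> H_field \<mu> u" "H_field \<mu> u \<le> 1"
    by (auto simp: H_field_def divide_simps)
qed

lemma nn_integral_gaussian_power_rescale:
  assumes q: "q > 0"
  shows "(\<integral>\<^sup>+s. ennreal (s ^ (2 * k + 1) * exp (- s\<^sup>2 * q\<^sup>2 / 2)) * indicator {0..} s \<partial>lborel)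
    = ennreal (half_gaussian_moment (2 * k + 1)) * ennreal ((1 / q\<^sup>2) ^ Suc k)"
proof -
  have "(\<integral>\<^sup>+s. ennreal (s ^ (2 * k + 1) * exp (- s\<^sup>2 * q\<^sup>2 / 2)) * indicator {0..} s \<partial>lborel)
    = ennreal \<bar>1 / q\<bar> * (\<integral>\<^sup>+t. ennreal ((0 + (1 / q) * t) ^ (2 * k + 1) * exp (- (0 + (1 / q) * t)\<^sup>2 * q\<^sup>2 / 2)) * indicator {0..} (0 + (1 / q) * t) \<partial>lborel)"
    using q by (intro nn_integral_real_affine) auto
  also have "\<dots> = ennreal (1 / q) * (\<integral>\<^sup>+t. ennreal ((1 / q) ^ (2 * k + 1)) * (ennreal (t ^ (2 * k + 1) * exp (- t\<^sup>2 / 2)) * indicator {0..} t) \<partial>lborel)"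
  proof -
    have eq: "ennreal ((0 + (1 / q) * t) ^ (2 * k + 1) * exp (- (0 + (1 / q) * t)\<^sup>2 * q\<^sup>2 / 2)) * indicator {0..} (0 + (1 / q) * t)
        = ennreal ((1 / q) ^ (2 * k + 1)) * (ennreal (t ^ (2 * k + 1) * exp (- t\<^sup>2 / 2)) * indicator {0..} t)" for t :: real
    proof -
      have "(0 + (1 / q) * t)\<^sup>2 * q\<^sup>2 = t\<^sup>2" using q by (simp add: power_divide)
      then show ?thesis
        using q by (auto simp: indicator_def zero_le_divide_iff power_mult_distrib[of "1 / q" t, simplified] power_divide ennreal_mult[symmetric] mult_ac)
    qed
    show ?thesis unfolding eq using q by simp
  qed
  also have "\<dots> = ennreal (1 / q) * (ennreal ((1 / q) ^ (2 * k + 1)) * (\<integral>\<^sup>+t. ennreal (t ^ (2 * k + 1) * exp (- t\<^sup>2 / 2)) * indicator {0..} t \<partial>lborel))"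
    by (subst nn_integral_cmult) auto
  also have "\<dots> = ennreal (1 / q) * (ennreal ((1 / q) ^ (2 * k + 1)) * ennreal (half_gaussian_moment (2 * k + 1)))"
    by (simp only: nn_integral_half_gaussian_moment)
  also have "\<dots> = ennreal ((1 / q) ^ Suc (2 * k + 1)) * ennreal (half_gaussian_moment (2 * k + 1))"
    using q by (subst mult.assoc[symmetric], subst ennreal_mult[symmetric]) auto
  also have "(1 / q) ^ Suc (2 * k + 1) = (1 / q\<^sup>2) ^ Suc k"
    by (simp add: power_one_over power_mult[symmetric] mult.commute flip: power_Suc)
  finally show ?thesis by (simp add: mult.commute)
qed

text \<open>
  Multiply the transform identity of \<open>integral_gaussian_exp_g_field\<close> by \<open>s ^ (2 * k + 1)\<close> and integrate over
  \<open>s \<ge> 0\<close>. On the left the inner integral over \<open>s\<close> is a power of \<open>1 / (norm (g x))\<^sup>2\<close> by rescaling; on the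
  right appears the integral for the factorial.
\<close>

lemma (in sphere_prob) nn_integral_gaussian_inverse_norm_g_field:
  assumes fin: "AE x in gaussian. I_field \<mu> x < \<infinity>"
  shows "ennreal (half_gaussian_moment (2 * k + 1)) * (\<integral>\<^sup>+x. ennreal ((1 / (norm (g_field \<mu> x))\<^sup>2) ^ Suc k) \<partial>gaussian)
    = ennreal (fact (2 * k + 1))"
proof -
  interpret G: prob_space "gaussian :: 'a measure" by (rule prob_space_gaussian)
  interpret P: pair_sigma_finite "gaussian :: 'a measure" "lborel :: real measure" ..
  let ?w = "\<lambda>s::real. ennreal (s ^ (2 * k + 1)) * indicator {0..} s"
  let ?e = "\<lambda>s x. exp (- s\<^sup>2 * (norm (g_field \<mu> x))\<^sup>2 / 2)"
  have "ennreal (half_gaussian_moment (2 * k + 1)) * (\<integral>\<^sup>+x. ennreal ((1 / (norm (g_field \<mu> x))\<^sup>2) ^ Suc k) \<partial>gaussian)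
      = (\<integral>\<^sup>+x. ennreal (half_gaussian_moment (2 * k + 1)) * ennreal ((1 / (norm (g_field \<mu> x))\<^sup>2) ^ Suc k) \<partial>gaussian)"
    by (rule nn_integral_cmult[symmetric]) measurable
  also have "\<dots> = (\<integral>\<^sup>+x. (\<integral>\<^sup>+s. ?w s * ennreal (?e s x) \<partial>lborel) \<partial>gaussian)"
  proof (rule nn_integral_cong_AE, use fin in eventually_elim)
    case (elim x)
    then have "g_field \<mu> x \<noteq> 0" using inner_self_g_field[of x] by auto
    then have "norm (g_field \<mu> x) > 0" by simp
    then have "ennreal (half_gaussian_moment (2 * k + 1)) * ennreal ((1 / (norm (g_field \<mu> x))\<^sup>2) ^ Suc k)
        = (\<integral>\<^sup>+s. ennreal (s ^ (2 * k + 1) * ?e s x) * indicator {0..} s \<partial>lborel)"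
      by (rule nn_integral_gaussian_power_rescale[symmetric])
    also have "\<dots> = (\<integral>\<^sup>+s. ?w s * ennreal (?e s x) \<partial>lborel)"
      by (intro nn_integral_cong) (auto simp: indicator_def ennreal_mult)
    finally show ?case .
  qed
  also have "\<dots> = (\<integral>\<^sup>+s. (\<integral>\<^sup>+x. ?w s * ennreal (?e s x) \<partial>gaussian) \<partial>lborel)"
    by (rule P.Fubini'[symmetric]) measurable
  also have "\<dots> = (\<integral>\<^sup>+s. ennreal (s ^ (2 * k + 1) * exp (- s)) * indicator {0..} s \<partial>lborel)"
  proof (rule nn_integral_cong)
    fix s :: real
    have "(\<integral>\<^sup>+x. ?w s * ennreal (?e s x) \<partial>gaussian) = ?w s * (\<integral>\<^sup>+x. ennreal (?e s x) \<partial>gaussian)"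
      by (rule nn_integral_cmult) measurable
    also have "(\<integral>\<^sup>+x. ennreal (?e s x) \<partial>gaussian) = ennreal (\<integral>x. ?e s x \<partial>gaussian)"
      by (intro nn_integral_eq_integral G.integrable_const_bound[where B=1]) auto
    also have "?w s * \<dots> = ennreal (s ^ (2 * k + 1) * exp (- s)) * indicator {0..} s"
      using integral_gaussian_exp_g_field[OF _ fin, of s]
      by (auto simp: indicator_def ennreal_mult simp del: power_Suc)
    finally show "(\<integral>\<^sup>+x. ?w s * ennreal (?e s x) \<partial>gaussian) = ennreal (s ^ (2 * k + 1) * exp (- s)) * indicator {0..} s" .
  qed
  also have "\<dots> = ennreal (fact (2 * k + 1))"
    by (simp only: nn_intergal_power_times_exp_Ici of_nat_fact)
  finally show ?thesis .
qed

lemma Beta_real_pos: "0 < a \<Longrightarrow> 0 < b \<Longrightarrow> 0 < Beta a (b :: real)"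
  by (simp add: Beta_def Gamma_real_pos)

lemma AE_gaussian_neq_0: "AE x in gaussian. x \<noteq> (0::'a::euclidean_space)"
  unfolding gaussian_def
  by (subst AE_density) (use AE_lborel_singleton[of "0::'a"] in \<open>auto elim: eventually_mono\<close>)

lemma AE_uniform_ball_neq_0: "AE x in uniform_ball. x \<noteq> (0::'a::euclidean_space)"
  by (rule AE_uniform_measureI) (use AE_lborel_singleton[of "0::'a"] in \<open>auto elim: eventually_mono\<close>)

text \<open>
  The polar formula, applied to the indicator of the exceptional directions, transfers the null set.
\<close>

lemma AE_gaussian_sgn:
  assumes [measurable]: "Measurable.pred borel P" and P: "AE x in uniform_ball. P (sgn x :: 'a::euclidean_space)"
  shows "AE x in gaussian. P (sgn x :: 'a)"
proof -
  define h where "h u = (indicator {u. \<not> P u} u :: ennreal)" for u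
  have [measurable]: "h \<in> borel_measurable borel" unfolding h_def by measurable
  have "(\<integral>\<^sup>+x. h (sgn x) \<partial>uniform_ball) = 0"
    using P by (subst nn_integral_0_iff_AE) (auto simp: h_def elim!: eventually_mono)
  then have "(\<integral>\<^sup>+x. ennreal (norm x ^ 0) * h (sgn x) \<partial>gaussian) = 0"
    by (subst nn_integral_gaussian_polar) auto
  then have "(\<integral>\<^sup>+x. h (sgn x) \<partial>gaussian) = 0" by simp
  then have "AE x in gaussian. h (sgn x) = 0"
    by (subst (asm) nn_integral_0_iff_AE) auto
  then show ?thesis by eventually_elim (auto simp: h_def indicator_def split: if_splits)
qed

context sphere_prob
begin

definition H_moment :: "nat \<Rightarrow> real"
  where "H_moment k = (\<integral>x. H_field \<mu> (sgn x) ^ k \<partial>uniform_ball)"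

context
  assumes AE_fin: "AE x in uniform_ball. I_field \<mu> (sgn x) < \<infinity>"
begin

lemma AE_gaussian_I_field: "AE x in gaussian. I_field \<mu> x < \<infinity>"
proof -
  have "AE x in gaussian. I_field \<mu> (sgn x) < \<infinity>"
    by (rule AE_gaussian_sgn[OF _ AE_fin]) measurable
  with AE_gaussian_neq_0 show ?thesis
  proof eventually_elim
    case (elim x)
    then show ?case by (auto simp: I_field_sgn ennreal_mult_less_top less_top)
  qed
qed

lemma AE_H_field_bounds: "AE x in uniform_ball. 0 \<le> H_field \<mu> (sgn x) \<and> H_field \<mu> (sgn x) \<le> 1"
  using AE_fin AE_uniform_ball_neq_0
  by eventually_elim (auto intro!: H_field_le_1 simp: norm_sgn)

lemma nn_integral_H_moment: "(\<integral>\<^sup>+x. ennreal (H_field \<mu> (sgn x)) ^ k \<partial>uniform_ball) = ennreal (H_moment k)"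
proof -
  interpret B: prob_space "uniform_ball :: 'a measure" by (rule prob_space_uniform_measure[OF emeasure_unit_ball])
  have "(\<integral>\<^sup>+x. ennreal (H_field \<mu> (sgn x)) ^ k \<partial>uniform_ball) = (\<integral>\<^sup>+x. ennreal (H_field \<mu> (sgn x) ^ k) \<partial>uniform_ball)"
    by (rule nn_integral_cong_AE, use AE_H_field_bounds in eventually_elim) (simp add: ennreal_power)
  also have "\<dots> = ennreal (H_moment k)"
    unfolding H_moment_def
  proof (intro nn_integral_eq_integral B.integrable_const_bound[where B=1])
    show "AE x in uniform_ball. norm (H_field \<mu> (sgn x) ^ k) \<le> 1"
      using AE_H_field_bounds by eventually_elim (simp add: power_le_one)
    show "AE x in uniform_ball. 0 \<le> H_field \<mu> (sgn x) ^ k"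
      using AE_H_field_bounds by eventually_elim simp
  qed measurable
  finally show ?thesis .
qed

lemma H_moment_Suc_eq:
  "half_gaussian_moment (2 * k + 1) * (half_gaussian_moment (2 * k + 1 + DIM('a)) / half_gaussian_moment (DIM('a) - 1)) * H_moment (Suc k)
    = fact (2 * k + 1)"
proof -
  have nonneg: "H_moment j \<ge> 0" for j
    unfolding H_moment_def by (intro integral_nonneg_AE) (use AE_H_field_bounds in \<open>auto elim: eventually_mono\<close>)
  have "(\<integral>\<^sup>+x. ennreal ((1 / (norm (g_field \<mu> x))\<^sup>2) ^ Suc k) \<partial>gaussian)
      = (\<integral>\<^sup>+x. ennreal (norm x ^ (2 * Suc k)) * ennreal (H_field \<mu> (sgn x)) ^ Suc k \<partial>gaussian)"
  proof (rule nn_integral_cong_AE, use AE_gaussian_neq_0 in eventually_elim)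
    case (elim x)
    have "H_field \<mu> (sgn x) \<ge> 0" by (simp add: H_field_def)
    then show ?case
      unfolding inverse_norm_g_field_square[OF elim]
      by (subst ennreal_power) (simp_all only: power_mult_distrib power_mult ennreal_mult zero_le_power norm_ge_zero)
  qed
  also have "\<dots> = ennreal (half_gaussian_moment (2 * Suc k + DIM('a) - 1) / half_gaussian_moment (DIM('a) - 1)) * ennreal (H_moment (Suc k))"
    unfolding nn_integral_H_moment[symmetric]
    by (rule nn_integral_gaussian_polar[where h="\<lambda>u. ennreal (H_field \<mu> u) ^ Suc k"]) (measurable, simp only: nn_integral_H_moment, simp)
  also have "2 * Suc k + DIM('a) - 1 = 2 * k + 1 + DIM('a)" by simp
  finally have "ennreal (fact (2 * k + 1)) = ennreal (half_gaussian_moment (2 * k + 1)) *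
      (ennreal (half_gaussian_moment (2 * k + 1 + DIM('a)) / half_gaussian_moment (DIM('a) - 1)) * ennreal (H_moment (Suc k)))"
    using nn_integral_gaussian_inverse_norm_g_field[OF AE_gaussian_I_field, of k] by simp
  also have "\<dots> = ennreal (half_gaussian_moment (2 * k + 1) * (half_gaussian_moment (2 * k + 1 + DIM('a)) / half_gaussian_moment (DIM('a) - 1)) * H_moment (Suc k))"
  proof -
    have "ennreal a * (ennreal b * ennreal c) = ennreal (a * b * c)" if "0 \<le> a" "0 \<le> b" "0 \<le> c" for a b c
      using that by (simp add: ennreal_mult mult.assoc)
    then show ?thesis
      using half_gaussian_moment_pos nonneg by (blast intro: less_imp_le divide_nonneg_pos)
  qed
  finally show ?thesis
    using half_gaussian_moment_pos nonneg
    by (subst (asm) ennreal_inj) (auto intro!: mult_nonneg_nonneg divide_nonneg_pos simp: less_imp_le)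
qed

text \<open>
  Quotients of consecutive instances of \<open>H_moment_Suc_eq\<close> contain Gaussian moments only through their recursion.
  The case \<open>k = 0\<close> is separate: there the identity for \<open>k = 0\<close> is compared with the total mass 1.
\<close>

lemma H_moment_recursion: "(2 * k + DIM('a)) * H_moment (Suc k) = (2 * k + 1) * H_moment k"
proof (cases k)
  case 0
  interpret B: prob_space "uniform_ball :: 'a measure" by (rule prob_space_uniform_measure[OF emeasure_unit_ball])
  let ?p = "DIM('a)"
  have "half_gaussian_moment (1 + ?p) = half_gaussian_moment ((?p - 1) + 2)"
    by (rule arg_cong[where f=half_gaussian_moment]) (use DIM_positive[where 'a='a] in linarith)
  also have "\<dots> = ?p * half_gaussian_moment (?p - 1)"
    unfolding half_gaussian_moment_add_2 by (simp add: of_nat_diff)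
  finally have "half_gaussian_moment (1 + ?p) / half_gaussian_moment (?p - 1) = ?p"
    using half_gaussian_moment_pos[of "?p - 1"] by simp
  moreover have "half_gaussian_moment 1 = 1" using half_gaussian_moment_odd[of 0] by simp
  ultimately have "?p * H_moment (Suc 0) = 1" using H_moment_Suc_eq[of 0] by simp
  moreover have "H_moment 0 = 1" using B.prob_space by (simp add: H_moment_def)
  ultimately show ?thesis using 0 by simp
next
  case (Suc j)
  let ?p = "DIM('a)"
  define A where "A = half_gaussian_moment (2 * j + 1)"
  define B where "B = half_gaussian_moment (2 * j + 1 + ?p)"
  define C where "C = half_gaussian_moment (?p - 1)"
  have pos: "A > 0" "B > 0" "C > 0" by (simp_all add: A_def B_def C_def half_gaussian_moment_pos)
  have 1: "A * (B / C) * H_moment (Suc j) = fact (2 * j + 1)"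
    unfolding A_def B_def C_def by (rule H_moment_Suc_eq)
  have "half_gaussian_moment (2 * Suc j + 1) = (2 * j + 2) * A"
    using half_gaussian_moment_add_2[of "2 * j + 1"] by (simp add: A_def)
  moreover have "half_gaussian_moment (2 * Suc j + 1 + ?p) = (2 * j + 2 + ?p) * B"
    using half_gaussian_moment_add_2[of "2 * j + 1 + ?p"] by (simp add: B_def)
  ultimately have "((2 * j + 2) * A) * (((2 * j + 2 + ?p) * B) / C) * H_moment (Suc (Suc j)) = fact (2 * Suc j + 1)"
    using H_moment_Suc_eq[of "Suc j"] by (simp only: C_def)
  also have "fact (2 * Suc j + 1) = (2 * real j + 3) * (2 * real j + 2) * (fact (2 * j + 1) :: real)"
    by (simp add: algebra_simps)
  also have "\<dots> = (2 * real j + 3) * (2 * real j + 2) * (A * (B / C) * H_moment (Suc j))"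
    by (simp only: 1)
  finally have "((2 * real j + 2) * A * (B / C)) * ((2 * real j + 2 + ?p) * H_moment (Suc (Suc j)))
      = ((2 * real j + 2) * A * (B / C)) * ((2 * real j + 3) * H_moment (Suc j))"
    by (simp add: mult_ac add_ac)
  moreover have "(2 * real j + 2) * A * (B / C) \<noteq> 0" using pos by simp
  ultimately have "(2 * real j + 2 + ?p) * H_moment (Suc (Suc j)) = (2 * real j + 3) * H_moment (Suc j)"
    by (metis mult_left_cancel)
  then show ?thesis using Suc by (simp add: algebra_simps)
qed

text \<open>
  The moments of the Beta law obey the same recursion, by the functional equation of the Beta function.
\<close>

lemma H_moment_eq_Beta:
  assumes "DIM('a) \<ge> 2"
  shows "H_moment k = Beta (1 / 2 + real k) ((real DIM('a) - 1) / 2) / Beta (1 / 2) ((real DIM('a) - 1) / 2)"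
proof (induction k)
  case 0
  interpret B: prob_space "uniform_ball :: 'a measure" by (rule prob_space_uniform_measure[OF emeasure_unit_ball])
  have "Beta (1 / 2) ((real DIM('a) - 1) / 2) > 0"
    using assms by (intro Beta_real_pos) auto
  then show ?case using B.prob_space by (simp add: H_moment_def)
next
  case (Suc k)
  let ?b = "(real DIM('a) - 1) / 2" and ?a = "1 / 2 + real k"
  have "(?a + ?b) * Beta (?a + 1) ?b = ?a * Beta ?a ?b"
    by (rule Beta_plus1_left) (auto elim!: nonpos_Ints_cases)
  then have B: "Beta (?a + 1) ?b = ?a / (?a + ?b) * Beta ?a ?b"
    using assms by (simp add: field_simps)
  have "H_moment (Suc k) = (2 * k + 1) / (2 * k + DIM('a)) * H_moment k"
  proof -
    have "2 * real k + real DIM('a) \<noteq> 0" using assms by linarith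
    then show ?thesis using H_moment_recursion[of k] by (simp add: nonzero_eq_divide_eq mult.commute)
  qed
  also have "(2 * k + 1) / (2 * k + DIM('a)) = (2 * real k + 1) / (2 * real k + real DIM('a))"
    by simp
  also have "\<dots> = ((2 * real k + 1) / 2) / ((2 * real k + real DIM('a)) / 2)"
  proof -
    have "x / y = (x / 2) / (y / 2)" for x y :: real by simp
    then show ?thesis .
  qed
  also have "\<dots> = ?a / (?a + ?b)"
    by (intro arg_cong2[where f="(/)"]) (simp_all add: field_simps)
  finally show ?case
    unfolding Suc.IH using B by (simp add: add_ac)
qed

end

end

section \<open>The Beta law\<close>

lemma nn_integral_beta_density_power:
  assumes a: "a > 0" and b: "b > 0"
  shows "(\<integral>\<^sup>+x. ennreal (beta_density a b x * x ^ k) \<partial>lborel) = ennreal (Beta (a + real k) b / Beta a b)"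
proof -
  have B: "Beta a b > 0" using a b by (rule Beta_real_pos)
  have "((\<lambda>t. (1 / Beta a b) * (t powr (a + real k - 1) * (1 - t) powr (b - 1))) has_integral (1 / Beta a b) * Beta (a + real k) b) {0..1}"
    using a b by (intro has_integral_mult_right has_integral_Beta_real) auto
  then have "(\<integral>\<^sup>+t. ennreal (indicator {0..1} t * ((1 / Beta a b) * (t powr (a + real k - 1) * (1 - t) powr (b - 1)))) \<partial>lborel)
      = ennreal ((1 / Beta a b) * Beta (a + real k) b)"
    using B by (intro nn_integral_has_integral_lebesgue) auto
  moreover have "(\<integral>\<^sup>+x. ennreal (beta_density a b x * x ^ k) \<partial>lborel)
      = (\<integral>\<^sup>+t. ennreal (indicator {0..1} t * ((1 / Beta a b) * (t powr (a + real k - 1) * (1 - t) powr (b - 1)))) \<partial>lborel)"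
  proof (rule nn_integral_cong_AE, use AE_lborel_singleton[of "0::real"] AE_lborel_singleton[of "1::real"] in eventually_elim)
    case (elim x)
    have "x powr (a + real k - 1) = x powr (a - 1) * x ^ k" if "x > 0"
      using that by (simp add: powr_realpow[symmetric] powr_add[symmetric] algebra_simps)
    then show ?case
      using elim by (auto simp: beta_density_def indicator_def mult_ac)
  qed
  ultimately show ?thesis by simp
qed

lemma borel_measurable_beta_density [measurable]: "beta_density a b \<in> borel_measurable borel"
  unfolding beta_density_def by measurable

lemma beta_density_nonneg: "a > 0 \<Longrightarrow> b > 0 \<Longrightarrow> beta_density a b x \<ge> 0"
  by (auto simp: beta_density_def intro!: divide_nonneg_pos Beta_real_pos)

lemma real_distribution_beta:
  assumes "a > 0" "b > 0"
  shows "real_distribution (density lborel (\<lambda>x. ennreal (beta_density a b x)))"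
proof -
  have "prob_space (density lborel (\<lambda>x. ennreal (beta_density a b x)))"
  proof
    have "emeasure (density lborel (\<lambda>x. ennreal (beta_density a b x))) UNIV = (\<integral>\<^sup>+x. ennreal (beta_density a b x * x ^ 0) \<partial>lborel)"
      by (subst emeasure_density) auto
    also have "\<dots> = 1"
      using assms Beta_real_pos[OF assms] by (subst nn_integral_beta_density_power) auto
    finally show "emeasure (density lborel (\<lambda>x. ennreal (beta_density a b x))) (space (density lborel (\<lambda>x. ennreal (beta_density a b x)))) = 1"
      by simp
  qed
  then show ?thesis by (simp add: real_distribution_def real_distribution_axioms_def)
qed

lemma integral_beta_power:
  assumes "a > 0" "b > 0"
  shows "(\<integral>x. x ^ k \<partial>density lborel (\<lambda>x. ennreal (beta_density a b x))) = Beta (a + real k) b / Beta a b"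
proof -
  have "(\<integral>x. x ^ k \<partial>density lborel (\<lambda>x. ennreal (beta_density a b x))) = (\<integral>x. beta_density a b x * x ^ k \<partial>lborel)"
    using assms by (subst integral_density) (auto simp: beta_density_nonneg)
  also have "\<dots> = enn2real (\<integral>\<^sup>+x. ennreal (beta_density a b x * x ^ k) \<partial>lborel)"
  proof (rule integral_eq_nn_integral)
    show "AE x in lborel. 0 \<le> beta_density a b x * x ^ k"
    proof (rule AE_I2)
      show "0 \<le> beta_density a b x * x ^ k" for x
        using beta_density_nonneg[OF assms, of x] by (cases "x > 0") (auto simp: beta_density_def)
    qed
  qed measurable
  also have "\<dots> = Beta (a + real k) b / Beta a b"
  proof -
    have "Beta (a + real k) b / Beta a b \<ge> 0"
      using assms by (intro divide_nonneg_pos less_imp_le[OF Beta_real_pos] Beta_real_pos) auto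
    then show ?thesis by (simp add: nn_integral_beta_density_power[OF assms])
  qed
  finally show ?thesis .
qed

lemma AE_beta_bounds: "AE x in density lborel (\<lambda>x. ennreal (beta_density a b x)). \<bar>x\<bar> \<le> 1"
  by (subst AE_density) (auto simp: beta_density_def split: if_splits)

lemma measurable_sphere_borel_ident: "(\<lambda>x. x) \<in> sphere_borel \<rightarrow>\<^sub>M borel"
  unfolding sphere_borel_def by (rule measurable_restrict_space1) simp

text \<open>
  Away from the origin \<open>sgn\<close> takes values on the sphere, so restricting the cone measure to the sphere loses no mass.
\<close>

lemma distr_uniform_sphere: "distr uniform_sphere borel (\<lambda>x. x) = distr (uniform_ball :: 'a::euclidean_space measure) borel sgn"
proof (rule measure_eqI)
  let ?D = "distr (uniform_ball :: 'a measure) borel sgn"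
  have sph: "AE x in ?D. x \<in> sphere 0 1"
    by (subst AE_distr_iff) (use AE_uniform_ball_neq_0 in \<open>auto simp: norm_sgn elim: eventually_mono\<close>)
  fix A :: "'a set" assume "A \<in> sets (distr uniform_sphere borel (\<lambda>x. x))"
  then have A: "A \<in> sets borel" by simp
  have meas: "(\<lambda>x. x) \<in> uniform_sphere \<rightarrow>\<^sub>M (borel :: 'a measure)"
    unfolding uniform_sphere_def by (rule measurable_restrict_space1) simp
  have "emeasure (distr uniform_sphere borel (\<lambda>x. x)) A = emeasure uniform_sphere (A \<inter> sphere 0 1)"
    using A meas by (subst emeasure_distr) (auto simp: uniform_sphere_def space_restrict_space)
  also have "\<dots> = emeasure ?D (A \<inter> sphere 0 1)"
    unfolding uniform_sphere_def by (rule emeasure_restrict_space) auto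
  also have "\<dots> = emeasure ?D A"
    using sph A by (intro emeasure_eq_AE) (auto elim: eventually_mono)
  finally show "emeasure (distr uniform_sphere borel (\<lambda>x. x)) A = emeasure ?D A" .
qed simp

theorem theorem7p1:
  fixes \<mu> :: "(real ^ 'n) measure"
    and M :: "'w measure"
    and U :: "'w \<Rightarrow> real ^ 'n"
  assumes "CARD('n) \<ge> 2"
    and "prob_space \<mu>"
    and "sets \<mu> = sets sphere_borel"
    and "prob_space M"
    and "U \<in> measurable M sphere_borel"
    and "distr M sphere_borel U = uniform_sphere"
    and "AE \<omega> in M. I_field \<mu> (U \<omega>) < \<infinity>"
  shows "(\<forall>u \<in> sphere 0 1. I_field \<mu> u < \<infinity> \<longrightarrow>
            integrable \<mu> (\<lambda>a. a /\<^sub>R (a \<bullet> u)) \<and>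
            u \<bullet> g_field \<mu> u = 1 \<and>
            H_field \<mu> u = (u \<bullet> N_field \<mu> u)\<^sup>2)
       \<and> distributed M lborel (\<lambda>\<omega>. H_field \<mu> (U \<omega>))
           (\<lambda>x. ennreal (beta_density (1 / 2) ((real CARD('n) - 1) / 2) x))"
proof -
  interpret mu: prob_space \<mu> by fact
  interpret M: prob_space M by fact
  interpret B: prob_space "uniform_ball :: (real ^ 'n) measure" by (rule prob_space_uniform_measure[OF emeasure_unit_ball])
  have mu_ident [simp]: "(\<lambda>x. x) \<in> \<mu> \<rightarrow>\<^sub>M borel"
    using measurable_sphere_borel_ident measurable_cong_sets[OF assms(3) refl] by blast
  \<comment> \<open>The image of \<open>\<mu>\<close> in the ambient space has the same fields and satisfies the assumptions of the locale.\<close>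
  define \<nu> where "\<nu> = distr \<mu> borel (\<lambda>x. x)"
  have "space \<mu> = sphere 0 1"
    using sets_eq_imp_space_eq[OF assms(3)] by (simp add: sphere_borel_def space_restrict_space)
  then have "AE a in \<mu>. norm a = 1" by (intro AE_I2) auto
  then have "AE a in \<nu>. norm a = 1"
    unfolding \<nu>_def by (subst AE_distr_iff) auto
  moreover have "prob_space \<nu>"
    unfolding \<nu>_def by (rule mu.prob_space_distr) simp
  moreover have "sets \<nu> = sets borel"
    by (simp add: \<nu>_def)
  ultimately interpret nu: sphere_prob \<nu>
    by (simp add: sphere_prob_def sphere_prob_axioms_def)
  have I: "I_field \<mu> = I_field \<nu>"
    unfolding I_field_def \<nu>_def by (subst nn_integral_distr) auto
  have g: "g_field \<mu> = g_field \<nu>"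
    unfolding g_field_def \<nu>_def by (subst integral_distr) auto
  have H: "H_field \<mu> = H_field \<nu>" unfolding H_field_def g ..
  have field: "integrable \<mu> (\<lambda>a. a /\<^sub>R (a \<bullet> u)) \<and> u \<bullet> g_field \<mu> u = 1 \<and> H_field \<mu> u = (u \<bullet> N_field \<mu> u)\<^sup>2"
    if "I_field \<mu> u < \<infinity>" for u
  proof (intro conjI)
    have fin: "I_field \<nu> u < \<infinity>" using that by (simp add: I)
    have "integrable \<nu> (\<lambda>a. a /\<^sub>R (a \<bullet> u))" by (rule nu.integrable_g_field[OF fin])
    then show "integrable \<mu> (\<lambda>a. a /\<^sub>R (a \<bullet> u))"
      unfolding \<nu>_def by (subst (asm) integrable_distr_eq) auto
    show 1: "u \<bullet> g_field \<mu> u = 1"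
      unfolding g by (rule nu.inner_self_g_field[OF fin])
    then show "H_field \<mu> u = (u \<bullet> N_field \<mu> u)\<^sup>2"
      by (simp add: H_field_def N_field_def power_divide divide_inverse power_inverse)
  qed
  have U [measurable]: "U \<in> M \<rightarrow>\<^sub>M borel"
    using measurable_compose[OF assms(5) measurable_sphere_borel_ident] by simp
  have law: "distr M borel U = distr uniform_ball borel sgn"
  proof -
    have "distr M borel U = distr (distr M sphere_borel U) borel (\<lambda>x. x)"
      by (subst distr_distr[OF measurable_sphere_borel_ident assms(5)]) (simp add: o_def)
    then show ?thesis by (simp only: assms(6) distr_uniform_sphere)
  qed
  have "AE u in distr M borel U. I_field \<nu> u < \<infinity>"
    using assms(7) by (subst AE_distr_iff) (auto simp: I)
  then have fin: "AE x in uniform_ball. I_field \<nu> (sgn x) < \<infinity>"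
    unfolding law by (subst (asm) AE_distr_iff) auto
  let ?b = "(real CARD('n) - 1) / 2"
  have b: "?b > 0" using assms(1) by simp
  have "distr M borel (\<lambda>\<omega>. H_field \<nu> (U \<omega>)) = distr (distr M borel U) borel (H_field \<nu>)"
    by (subst distr_distr) (auto simp: o_def)
  also have "\<dots> = distr uniform_ball borel (\<lambda>x. H_field \<nu> (sgn x))"
    unfolding law by (subst distr_distr) (auto simp: o_def)
  also have "\<dots> = density lborel (\<lambda>x. ennreal (beta_density (1 / 2) ?b x))"
  proof (rule real_distribution_eq_moments)
    show "real_distribution (distr (uniform_ball :: (real ^ 'n) measure) borel (\<lambda>x. H_field \<nu> (sgn x)))"
      by (rule B.real_distribution_distr) measurable
    show "real_distribution (density lborel (\<lambda>x. ennreal (beta_density (1 / 2) ?b x)))"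
      using b by (intro real_distribution_beta) auto
    have "AE x in uniform_ball. \<bar>H_field \<nu> (sgn x)\<bar> \<le> 1"
      using nu.AE_H_field_bounds[OF fin] by eventually_elim simp
    then show "AE x in distr (uniform_ball :: (real ^ 'n) measure) borel (\<lambda>x. H_field \<nu> (sgn x)). \<bar>x\<bar> \<le> 1"
      by (subst AE_distr_iff) auto
    show "AE x in density lborel (\<lambda>x. ennreal (beta_density (1 / 2) ?b x)). \<bar>x\<bar> \<le> 1"
      by (rule AE_beta_bounds)
    fix k
    have "(\<integral>x. x ^ k \<partial>distr (uniform_ball :: (real ^ 'n) measure) borel (\<lambda>x. H_field \<nu> (sgn x))) = nu.H_moment k"
      unfolding nu.H_moment_def by (subst integral_distr) auto
    also have "\<dots> = Beta (1 / 2 + real k) ?b / Beta (1 / 2) ?b"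
      using nu.H_moment_eq_Beta[OF fin, of k] assms(1) by simp
    also have "\<dots> = (\<integral>x. x ^ k \<partial>density lborel (\<lambda>x. ennreal (beta_density (1 / 2) ?b x)))"
      using b by (subst integral_beta_power) auto
    finally show "(\<integral>x. x ^ k \<partial>distr (uniform_ball :: (real ^ 'n) measure) borel (\<lambda>x. H_field \<nu> (sgn x)))
        = (\<integral>x. x ^ k \<partial>density lborel (\<lambda>x. ennreal (beta_density (1 / 2) ?b x)))" .
  qed
  finally have "distributed M lborel (\<lambda>\<omega>. H_field \<mu> (U \<omega>)) (\<lambda>x. ennreal (beta_density (1 / 2) ?b x))"
    unfolding distributed_def H by (simp cong: distr_cong)
  with field show ?thesis by blast
qed

end
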